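(* Let $V$ be a closed isometric operator in a Hilbert space $H$, and let $\Delta$ be an open arc of $\mathbb{T}$ such that $\zeta^{-1}$ is a point of the regular type of $V$ for all $\zeta\in\Delta$. Let the following condition be satisfied: $$P^H_{M_\infty}M_\zeta=M_\infty,\qquad\forall\zeta\in\Delta.$$ Let $\mathbf{R}_z=\mathbf{R}_z(V)$ be an arbitrary generalized resolvent of $V$, and let $C(\lambda;0)\in\mathcal{S}(N_0;N_\infty)$ correspond to $\mathbf{R}_z(V)$ by Inin's formula (with base point $0$). Then $\mathbf{R}_z(V)$ has an analytic continuation to the set $\mathbb{D}\cup\mathbb{D}_e\cup\Delta$ if and only if the following conditions are satisfied: 1) $C(\lambda;0)$ has an extension to the set $\mathbb{D}\cup\Delta$ which is continuous in the uniform operator (norm) topology; 2) the extended $C(\lambda;0)$ maps $N_0$ isometrically onto the whole of $N_\infty$, for all $\lambda\in\Delta$; 3) the operator $C(\lambda;0)-W_\lambda$ is invertible for all $\lambda\in\Delta$, and $$(C(\lambda;0)-W_\lambda)N_0=N_\infty,\qquad\forall\lambda\in\Delta.$$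
   Context: All Hilbert spaces are complex and separable. $\mathbb{D}=\{|z|<1\}$, $\mathbb{D}_e=\{|z|>1\}$, $\mathbb{T}=\{|z|=1\}$, $\mathbb{T}_e=\mathbb{D}\cup\mathbb{D}_e$. A closed isometric operator $V$ in $H$ is a linear isometry defined on a closed subspace $D(V)\subseteq H$ with range $R(V)\subseteq H$. $E_H$ is the identity on $H$, and $P^H_L$ is the orthogonal projection of $H$ onto a closed subspace $L$. "Invertible" means injective, so that the inverse exists on the range. Generalized resolvent: if $U\supseteq V$ is a unitary operator in a Hilbert space $\widetilde H\supseteq H$, the function $\mathbf{R}_\zeta h=P^{\widetilde H}_H(E_{\widetilde H}-\zeta U)^{-1}h$, $h\in H$, $\zeta\in\mathbb{T}_e$, is a generalized resolvent of $V$. An analytic continuation to $\mathbb{D}\cup\mathbb{D}_e\cup\Delta$ means an analytic operator-valued function on this set that coincides with $\mathbf{R}_z$ on $\mathbb{D}\cup\mathbb{D}_e$. Set $M_\zeta=(E_H-\zeta V)D(V)$, $N_\zeta=H\ominus M_\zeta$ for $\zeta\in\mathbb{C}$ (orthogonal complement), and $M_\infty=R(V)$, $N_\infty=H\ominus R(V)$. In particular $M_0=D(V)$, $N_0=H\ominus D(V)$. A point $\lambda\in\mathbb{C}$ is a point of the regular type of $V$ if $V-\lambda E_H$ has a bounded inverse defined on its range. $\mathcal{S}(H_1;H_2)$ is the set of all analytic operator-valued functions $F$ on $\mathbb{D}$ whose values $F(\zeta)$ are linear contractions with domain $H_1$ and range contained in $H_2$. Inin's formula with base point $0$ (known; it coincides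 with Chumakin's formula): $$\mathbf{R}_\zeta=\left[E_H-\zeta\,(V\oplus C(\zeta;0))\right]^{-1},\quad\zeta\in\mathbb{D},$$ establishes a one-to-one correspondence between all generalized resolvents of $V$ and all functions $C(\zeta;0)\in\mathcal{S}(N_0;N_\infty)$; here $V\oplus C$ acts as $V$ on $M_0$ and as $C$ on $N_0$. For $\zeta\in\mathbb{T}$ the operator $W_\zeta$, with domain $D(W_\zeta)=P^H_{N_0}N_\zeta$, is defined by $$W_\zeta P^H_{N_0}f=\zeta^{-1}P^H_{N_\infty}f,\quad f\in N_\zeta.$$ It is well defined and isometric; when $\zeta^{-1}$ is a point of the regular type of $V$ one has $D(W_\zeta)=N_0$ and $R(W_\zeta)=N_\infty$. *)

theory Defs
  imports "HOL-Analysis.Analysis"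
begin

text \<open>
  Complex inner product spaces are built on top of the class \<open>real_inner\<close>, whose norm and topology
  they inherit; positive definiteness of \<open>cinner\<close> follows from \<open>inner_eq_Re_cinner\<close>.  The inner
  product is linear in the first argument.
\<close>

class complex_inner = real_inner +
  fixes scaleC :: "complex \<Rightarrow> 'a \<Rightarrow> 'a"  (infixr "*\<^sub>C" 75)
    and cinner :: "'a \<Rightarrow> 'a \<Rightarrow> complex"
  assumes scaleC_add_right: "a *\<^sub>C (x + y) = a *\<^sub>C x + a *\<^sub>C y"
    and scaleC_add_left: "(a + b) *\<^sub>C x = a *\<^sub>C x + b *\<^sub>C x"
    and scaleC_scaleC: "a *\<^sub>C (b *\<^sub>C x) = (a * b) *\<^sub>C x"
    and scaleC_of_real: "complex_of_real r *\<^sub>C x = r *\<^sub>R x"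
    and cinner_commute: "cinner x y = cnj (cinner y x)"
    and cinner_add_left: "cinner (x + y) z = cinner x z + cinner y z"
    and cinner_scaleC_left: "cinner (a *\<^sub>C x) y = a * cinner x y"
    and inner_eq_Re_cinner: "inner x y = Re (cinner x y)"

class separable_chilbert = complex_inner + complete_space +
  assumes separable: "\<exists>S::'a set. countable S \<and> (\<forall>x. \<forall>e>0. \<exists>s\<in>S. dist s x < e)"

instantiation complex :: separable_chilbert
begin

definition scaleC_complex :: "complex \<Rightarrow> complex \<Rightarrow> complex"
  where "scaleC_complex a x = a * x"

definition cinner_complex :: "complex \<Rightarrow> complex \<Rightarrow> complex"
  where "cinner_complex x y = x * cnj y"

instance
proof
  obtain S :: "complex set" where "countable S"
    and S: "\<And>X. open X \<Longrightarrow> X \<noteq> {} \<Longrightarrow> \<exists>s\<in>S. s \<in> X"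
    using countable_dense_setE by blast
  have "\<exists>s\<in>S. dist s x < e" if "e > 0" for x e
    using S[of "ball x e"] that by (auto simp: dist_commute)
  with \<open>countable S\<close> show "\<exists>S::complex set. countable S \<and> (\<forall>x. \<forall>e>0. \<exists>s\<in>S. dist s x < e)"
    by blast
qed (auto simp: scaleC_complex_def cinner_complex_def inner_complex_def algebra_simps
       scaleR_conv_of_real)

end

definition csubspace :: "'a::complex_inner set \<Rightarrow> bool"
  where "csubspace L \<longleftrightarrow>
    0 \<in> L \<and> (\<forall>x\<in>L. \<forall>y\<in>L. x + y \<in> L) \<and> (\<forall>a. \<forall>x\<in>L. a *\<^sub>C x \<in> L)"

definition clinear_on :: "'a::complex_inner set \<Rightarrow> ('a \<Rightarrow> 'b::complex_inner) \<Rightarrow> bool"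
  where "clinear_on L T \<longleftrightarrow>
    (\<forall>x\<in>L. \<forall>y\<in>L. T (x + y) = T x + T y) \<and> (\<forall>a. \<forall>x\<in>L. T (a *\<^sub>C x) = a *\<^sub>C T x)"

definition bounded_clinear_on :: "'a::complex_inner set \<Rightarrow> ('a \<Rightarrow> 'b::complex_inner) \<Rightarrow> bool"
  where "bounded_clinear_on L T \<longleftrightarrow>
    clinear_on L T \<and> (\<exists>B. \<forall>x\<in>L. norm (T x) \<le> B * norm x)"

definition ortho_compl :: "'a::complex_inner set \<Rightarrow> 'a set"
  where "ortho_compl L = {x. \<forall>y\<in>L. cinner x y = 0}"

text \<open>Meaningful when \<open>L\<close> is a closed subspace of a Hilbert space.\<close>

definition ortho_proj :: "'a::complex_inner set \<Rightarrow> 'a \<Rightarrow> 'a"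
  where "ortho_proj L x = (THE p. p \<in> L \<and> x - p \<in> ortho_compl L)"

definition unitary_op :: "('a::complex_inner \<Rightarrow> 'a) \<Rightarrow> bool"
  where "unitary_op U \<longleftrightarrow>
    clinear_on UNIV U \<and> (\<forall>x y. cinner (U x) (U y) = cinner x y) \<and> surj U"


section \<open>Analytic and norm-continuous operator-valued functions\<close>

text \<open>
  An operator with domain a subspace \<open>L\<close> is represented by a total function of which only the
  values on \<open>L\<close> are relevant.  For operators on \<open>L\<close>, the estimate
  \<open>\<forall>x\<in>L. norm (T x) \<le> e * norm x\<close> says that the operator norm of \<open>T\<close> is at most \<open>e\<close>.
\<close>

definition norm_continuous_on ::
    "complex set \<Rightarrow> 'a::complex_inner set \<Rightarrow> (complex \<Rightarrow> 'a \<Rightarrow> 'b::complex_inner) \<Rightarrow> bool"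
  where "norm_continuous_on S L F \<longleftrightarrow>
    (\<forall>z\<in>S. bounded_clinear_on L (F z)) \<and>
    (\<forall>z\<in>S. \<forall>e>0. \<forall>\<^sub>F w in at z within S. \<forall>x\<in>L. norm (F w x - F z x) \<le> e * norm x)"

text \<open>
  Analyticity on an open set \<open>S\<close>: the values are bounded operators and the difference quotients
  converge in operator norm.
\<close>

definition analytic_op_on ::
    "complex set \<Rightarrow> 'a::complex_inner set \<Rightarrow> (complex \<Rightarrow> 'a \<Rightarrow> 'b::complex_inner) \<Rightarrow> bool"
  where "analytic_op_on S L F \<longleftrightarrow>
    (\<forall>z\<in>S. bounded_clinear_on L (F z)) \<and>
    (\<forall>z\<in>S. \<exists>F'. bounded_clinear_on L F' \<and>
      (\<forall>e>0. \<forall>\<^sub>F w in at z. \<forall>x\<in>L.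
         norm (inverse (w - z) *\<^sub>C (F w x - F z x) - F' x) \<le> e * norm x))"

definition schur_class ::
    "'a::complex_inner set \<Rightarrow> 'b::complex_inner set \<Rightarrow> (complex \<Rightarrow> 'a \<Rightarrow> 'b) set"
  where "schur_class H1 H2 = {F. analytic_op_on (ball 0 1) H1 F \<and>
    (\<forall>z\<in>ball 0 1. \<forall>x\<in>H1. F z x \<in> H2 \<and> norm (F z x) \<le> norm x)}"


section \<open>Isometric operators\<close>

text \<open>
  A partial operator in \<open>H\<close> (the whole type) is given by its domain \<open>D\<close> and a total function \<open>V\<close>
  whose values outside \<open>D\<close> are irrelevant.
\<close>

definition closed_isometric :: "'a::complex_inner set \<Rightarrow> ('a \<Rightarrow> 'a) \<Rightarrow> bool"
  where "closed_isometric D V \<longleftrightarrow>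
    csubspace D \<and> closed D \<and> clinear_on D V \<and> (\<forall>x\<in>D. norm (V x) = norm x)"

definition regular_type_point :: "'a::complex_inner set \<Rightarrow> ('a \<Rightarrow> 'a) \<Rightarrow> complex \<Rightarrow> bool"
  where "regular_type_point D V c \<longleftrightarrow>
    (let T = (\<lambda>x. V x - c *\<^sub>C x) in
      inj_on T D \<and> (\<exists>B. \<forall>y\<in>T ` D. norm (the_inv_into D T y) \<le> B * norm y))"

definition M_sp :: "'a::complex_inner set \<Rightarrow> ('a \<Rightarrow> 'a) \<Rightarrow> complex \<Rightarrow> 'a set"
  where "M_sp D V z = (\<lambda>x. x - z *\<^sub>C V x) ` D"

definition N_sp :: "'a::complex_inner set \<Rightarrow> ('a \<Rightarrow> 'a) \<Rightarrow> complex \<Rightarrow> 'a set"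
  where "N_sp D V z = ortho_compl (M_sp D V z)"

definition M_inf :: "'a::complex_inner set \<Rightarrow> ('a \<Rightarrow> 'a) \<Rightarrow> 'a set"
  where "M_inf D V = V ` D"

definition N_inf :: "'a::complex_inner set \<Rightarrow> ('a \<Rightarrow> 'a) \<Rightarrow> 'a set"
  where "N_inf D V = ortho_compl (M_inf D V)"

text \<open>
  The operator \<open>W\<^sub>z\<close> (\<open>z\<close> on the unit circle), with domain \<open>ortho_proj (N_sp D V 0) ` N_sp D V z\<close>;
  the value does not depend on the choice of \<open>f\<close>.
\<close>

definition W_op :: "'a::complex_inner set \<Rightarrow> ('a \<Rightarrow> 'a) \<Rightarrow> complex \<Rightarrow> 'a \<Rightarrow> 'a"
  where "W_op D V z x = (THE y. \<exists>f\<in>N_sp D V z.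
    x = ortho_proj (N_sp D V 0) f \<and> y = inverse z *\<^sub>C ortho_proj (N_inf D V) f)"

text \<open>The operator \<open>V \<oplus> C\<close>, acting as \<open>V\<close> on \<open>M\<^sub>0 = D\<close> and as \<open>C\<close> on \<open>N\<^sub>0\<close>.\<close>

definition oplus_op :: "'a::complex_inner set \<Rightarrow> ('a \<Rightarrow> 'a) \<Rightarrow> ('a \<Rightarrow> 'a) \<Rightarrow> 'a \<Rightarrow> 'a"
  where "oplus_op D V C x = V (ortho_proj (M_sp D V 0) x) + C (ortho_proj (N_sp D V 0) x)"


section \<open>Generalized resolvents\<close>

text \<open>
  The inclusion of \<open>H\<close> into the larger space is a linear isometric embedding \<open>J\<close>, so that
  \<open>U \<supseteq> V\<close> means \<open>U \<circ> J = J \<circ> V\<close> on \<open>D\<close>.  The values of \<open>R\<close> on the unit circle are not constrained.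
\<close>

definition isometric_embedding :: "('a::complex_inner \<Rightarrow> 'b::complex_inner) \<Rightarrow> bool"
  where "isometric_embedding J \<longleftrightarrow>
    clinear_on UNIV J \<and> (\<forall>x y. cinner (J x) (J y) = cinner x y)"

definition generalized_resolvent ::
    "'a::separable_chilbert set \<Rightarrow> ('a \<Rightarrow> 'a) \<Rightarrow> ('a \<Rightarrow> 'b::separable_chilbert) \<Rightarrow> ('b \<Rightarrow> 'b) \<Rightarrow>
      (complex \<Rightarrow> 'a \<Rightarrow> 'a) \<Rightarrow> bool"
  where "generalized_resolvent D V J U R \<longleftrightarrow>
    isometric_embedding J \<and> unitary_op U \<and> (\<forall>x\<in>D. U (J x) = J (V x)) \<and>
    (\<forall>z\<in>- sphere 0 1. \<forall>h.
       J (R z h) = ortho_proj (range J) (inv (\<lambda>y. y - z *\<^sub>C U y) (J h)))"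

text \<open>Inin's formula with base point \<open>0\<close>.\<close>

definition inin_corresponds ::
    "'a::separable_chilbert set \<Rightarrow> ('a \<Rightarrow> 'a) \<Rightarrow> (complex \<Rightarrow> 'a \<Rightarrow> 'a) \<Rightarrow> (complex \<Rightarrow> 'a \<Rightarrow> 'a) \<Rightarrow> bool"
  where "inin_corresponds D V R C \<longleftrightarrow>
    C \<in> schur_class (N_sp D V 0) (N_inf D V) \<and>
    (\<forall>z\<in>ball 0 1. R z = inv (\<lambda>x. x - z *\<^sub>C oplus_op D V (C z) x))"

definition has_analytic_continuation ::
    "(complex \<Rightarrow> 'a::complex_inner \<Rightarrow> 'a) \<Rightarrow> complex set \<Rightarrow> bool"
  where "has_analytic_continuation R \<Delta> \<longleftrightarrow>
    (\<exists>F. analytic_op_on (- sphere 0 1 \<union> \<Delta>) UNIV F \<and> (\<forall>z\<in>- sphere 0 1. F z = R z))"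

definition open_arc :: "complex set \<Rightarrow> bool"
  where "open_arc \<Delta> \<longleftrightarrow> (\<exists>a b::real. a < b \<and> b \<le> a + 2 * pi \<and> \<Delta> = cis ` {a<..<b})"

end

theory Submission
  imports Defs "HOL-Complex_Analysis.Complex_Analysis"
begin

text \<open>
  Write \<open>T z = V \<oplus> C z\<close>, so that \<open>R z = (1 - z T z)\<^sup>-\<^sup>1\<close> in the disc.  Two facts carry the argument.

  The first is a symmetry.  Since \<open>R\<close> compresses the resolvent of a unitary operator,
  \<open>\<langle>R z x, y\<rangle> + \<langle>x, R w y\<rangle> = \<langle>x, y\<rangle>\<close> whenever \<open>z * cnj w = 1\<close>
  (\<open>generalized_resolvent_symmetry\<close>).  On the unit circle \<open>w = z\<close>, and the identity then says that the
  operator has real part one half, equivalently that \<open>z T z\<close>, its Cayley transform, is isometric.  An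
  everywhere defined operator with this property is automatically bounded
  (\<open>adjoint_pair_bounded\<close>), and a bounded one is automatically bijective (\<open>real_part_half_bij\<close>).

  The second compares an isometric extension \<open>T\<close> of \<open>V\<close> with \<open>W\<^sub>\<zeta>\<close> at a point \<open>\<zeta>\<close> of the arc.  For
  \<open>f \<in> N\<^sub>\<zeta>\<close> the vector \<open>(1 - \<zeta> T) f\<close> is \<open>-\<zeta> (T - W\<^sub>\<zeta>) h\<close>, where \<open>h\<close> is the projection of \<open>f\<close> to the
  complement of \<open>D\<close>, and \<open>1 - \<zeta> T\<close> sends a vector into the complement of the range of \<open>V\<close> exactly when
  the vector lies in \<open>N\<^sub>\<zeta>\<close>.  Hence \<open>1 - \<zeta> T\<close> is bijective on the whole space if and only if
  \<open>T - W\<^sub>\<zeta>\<close> is bijective between the two complements (\<open>bij_resolvent_iff\<close>).  The condition on the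
  projection of \<open>M\<^sub>\<zeta>\<close> enters here twice: it shows that the domain of \<open>W\<^sub>\<zeta>\<close> is the whole complement of
  \<open>D\<close>, and it reduces surjectivity to right-hand sides orthogonal to the range of \<open>V\<close>.

  If \<open>R\<close> continues analytically, the continuation \<open>F\<close> inherits the symmetry, so on the arc it is
  invertible and \<open>z\<^sup>-\<^sup>1 (1 - (F z)\<^sup>-\<^sup>1)\<close> is an isometric extension of \<open>V\<close>.  Its restriction to the
  complement of \<open>D\<close> is the boundary value of \<open>C\<close>: inversion is norm continuous, and the extension is onto
  because a proper isometry never has a bijective \<open>1 - z T\<close> on the circle.

  Conversely, from the boundary values of \<open>C\<close> one obtains bounded inverses \<open>(1 - z T z)\<^sup>-\<^sup>1\<close> on the arc that
  continue \<open>R\<close> norm continuously from inside the disc.  The symmetry extends the continuity to the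
  outside (\<open>norm_continuous_on_reflect\<close>).  Then \<open>\<langle>F z x, y\<rangle>\<close> is continuous on an open set and holomorphic
  off the circle, so holomorphic by Morera's theorem, and locally uniform Cauchy estimates turn weak
  holomorphy into differentiability in operator norm (\<open>analytic_op_across_circle\<close>).
\<close>

section \<open>Complex inner products\<close>

interpretation cvec: vector_space "scaleC :: complex \<Rightarrow> 'a \<Rightarrow> 'a::complex_inner"
proof
  show "1 *\<^sub>C x = x" for x :: 'a
    using scaleC_of_real[of 1 x] by simp
qed (simp_all add: scaleC_add_right scaleC_add_left scaleC_scaleC)

declare cvec.scale_scale [simp del]

lemma scaleC_inverse_cancel [simp]:
  fixes x :: "'a::complex_inner"
  assumes "z \<noteq> 0"
  shows "inverse z *\<^sub>C z *\<^sub>C x = x" "z *\<^sub>C inverse z *\<^sub>C x = x"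
  using assms by (simp_all add: scaleC_scaleC)

lemma cinner_diff_left: "cinner (x - y) z = cinner x z - cinner y z"
  using cinner_add_left[of "x - y" y z] by simp

lemma cinner_zero_left [simp]: "cinner 0 z = 0"
  using cinner_diff_left[of z z z] by simp

lemma cinner_zero_right [simp]: "cinner z 0 = 0"
  by (subst cinner_commute) simp

lemma cinner_add_right: "cinner x (y + z) = cinner x y + cinner x z"
  by (metis cinner_add_left cinner_commute complex_cnj_add)

lemma cinner_diff_right: "cinner x (y - z) = cinner x y - cinner x z"
  by (metis cinner_diff_left cinner_commute complex_cnj_diff)

lemma cinner_scaleC_right: "cinner x (a *\<^sub>C y) = cnj a * cinner x y"
  by (metis cinner_scaleC_left cinner_commute complex_cnj_mult)

lemmas cinner_linear =
  cinner_add_left cinner_add_right cinner_diff_left cinner_diff_right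
  cinner_scaleC_left cinner_scaleC_right

lemma cinner_eq_zero_commute: "cinner x y = 0 \<longleftrightarrow> cinner y x = 0"
  by (metis cinner_commute complex_cnj_zero)

lemma cinner_self: "cinner x x = complex_of_real ((norm x)\<^sup>2)"
proof -
  have "Im (cinner x x) = 0"
    by (metis cinner_commute cnj.simps(2) equal_neg_zero)
  moreover have "Re (cinner x x) = (norm x)\<^sup>2"
    by (simp add: inner_eq_Re_cinner[symmetric] power2_norm_eq_inner)
  ultimately show ?thesis
    by (simp add: complex_eq_iff)
qed

lemma cinner_self_eq_0 [simp]: "cinner x x = 0 \<longleftrightarrow> x = 0"
  by (simp add: cinner_self)

lemma norm_scaleC [simp]: "norm (a *\<^sub>C x) = cmod a * norm x"
proof -
  have "cinner (a *\<^sub>C x) (a *\<^sub>C x) = (a * cnj a) * cinner x x"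
    by (simp only: cinner_scaleC_left cinner_scaleC_right mult.assoc mult.left_commute)
  then have "complex_of_real ((norm (a *\<^sub>C x))\<^sup>2) = complex_of_real ((cmod a * norm x)\<^sup>2)"
    unfolding cinner_self complex_norm_square[symmetric] by (simp add: power_mult_distrib)
  then show ?thesis
    by (simp only: of_real_eq_iff power2_eq_iff_nonneg norm_ge_zero mult_nonneg_nonneg)
qed

lemma norm_cinner_le: "cmod (cinner x y) \<le> norm x * norm y"
proof (cases "cinner x y = 0")
  case False
  \<comment> \<open>rotating \<open>x\<close> makes the complex product real, and the real inequality applies\<close>
  define a where "a = cnj (cinner x y) / cmod (cinner x y)"
  have "cmod a = 1"
    using False by (simp add: a_def norm_divide)
  have "cinner (a *\<^sub>C x) y = cmod (cinner x y)"
    using False by (simp add: a_def cinner_linear field_simps complex_norm_square[symmetric] power2_eq_square)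
  then have "cmod (cinner x y) = inner (a *\<^sub>C x) y"
    by (simp add: inner_eq_Re_cinner)
  also have "\<dots> \<le> norm (a *\<^sub>C x) * norm y"
    by (rule norm_cauchy_schwarz)
  finally show ?thesis
    using \<open>cmod a = 1\<close> by simp
qed simp

lemma cinner_eqI: "x = y" if "\<And>u. cinner x u = cinner y u"
proof -
  have "cinner (x - y) (x - y) = 0"
    using that[of "x - y"] by (simp only: cinner_diff_left) simp
  then show ?thesis
    by simp
qed

lemma norm_leI_cinner:
  assumes "b \<ge> 0" and "\<And>y. cmod (cinner x y) \<le> b * norm y"
  shows "norm x \<le> b"
proof (cases "x = 0")
  case False
  have "norm x * norm x \<le> b * norm x"
    using assms(2)[of x] by (simp add: cinner_self power2_eq_square norm_mult)
  then show ?thesis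
    using False by simp
qed (use assms in simp)

lemma polarization:
  assumes "inner x y = inner u v" and "inner (\<i> *\<^sub>C x) y = inner (\<i> *\<^sub>C u) v"
  shows "cinner x y = cinner u v"
  using assms by (simp add: inner_eq_Re_cinner cinner_scaleC_left complex_eq_iff)

section \<open>Subspaces, linear maps and orthogonal projections\<close>

lemma csubspace_UNIV [simp]: "csubspace UNIV"
  by (simp add: csubspace_def)

lemma csubspace_0: "csubspace L \<Longrightarrow> 0 \<in> L"
  and csubspace_add: "csubspace L \<Longrightarrow> x \<in> L \<Longrightarrow> y \<in> L \<Longrightarrow> x + y \<in> L"
  and csubspace_scaleC: "csubspace L \<Longrightarrow> x \<in> L \<Longrightarrow> a *\<^sub>C x \<in> L"
  by (simp_all add: csubspace_def)

lemma csubspace_diff: "csubspace L \<Longrightarrow> x \<in> L \<Longrightarrow> y \<in> L \<Longrightarrow> x - y \<in> L"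
  using csubspace_add[of L x "(-1) *\<^sub>C y"] csubspace_scaleC[of L y "-1"] by simp

lemma csubspace_ortho_compl [simp]: "csubspace (ortho_compl A)"
  by (auto simp: csubspace_def ortho_compl_def cinner_linear)

lemma clinear_onD:
  assumes "clinear_on L T"
  shows "x \<in> L \<Longrightarrow> y \<in> L \<Longrightarrow> T (x + y) = T x + T y" "x \<in> L \<Longrightarrow> T (a *\<^sub>C x) = a *\<^sub>C T x"
  using assms by (simp_all add: clinear_on_def)

lemma clinear_on_0: "clinear_on L T \<Longrightarrow> csubspace L \<Longrightarrow> T 0 = 0"
  using clinear_onD(2)[of L T 0 0] csubspace_0[of L] by simp

lemma clinear_on_diff:
  assumes "clinear_on L T" "csubspace L" "x \<in> L" "y \<in> L"
  shows "T (x - y) = T x - T y"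
  using clinear_onD(1)[OF assms(1), of x "(-1) *\<^sub>C y"] clinear_onD(2)[OF assms(1), of y "-1"]
    csubspace_scaleC[of L y "-1"] assms
  by simp

lemma csubspace_image:
  assumes "clinear_on L T" "csubspace L"
  shows "csubspace (T ` L)"
  unfolding csubspace_def
proof (intro conjI ballI allI)
  show "0 \<in> T ` L"
    using clinear_on_0[OF assms] csubspace_0[OF assms(2)] by force
  show "x + y \<in> T ` L" if "x \<in> T ` L" "y \<in> T ` L" for x y
    using that clinear_onD(1)[OF assms(1)] csubspace_add[OF assms(2)]
    by (metis (no_types, lifting) image_iff)
  show "a *\<^sub>C x \<in> T ` L" if "x \<in> T ` L" for x a
    using that clinear_onD(2)[OF assms(1)] csubspace_scaleC[OF assms(2)]
    by (metis (no_types, lifting) image_iff)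
qed

lemma isometry_on_cinner:
  assumes T: "clinear_on L T" and L: "csubspace L"
    and iso: "\<And>x. x \<in> L \<Longrightarrow> norm (T x) = norm x" and "x \<in> L" "y \<in> L"
  shows "cinner (T x) (T y) = cinner x y"
proof -
  have real: "inner (T u) (T v) = inner u v" if "u \<in> L" "v \<in> L" for u v
  proof -
    have "norm (T u + T v) = norm (u + v)"
      using iso[OF csubspace_add[OF L that]] clinear_onD(1)[OF T that] by simp
    then show ?thesis
      using iso[OF that(1)] iso[OF that(2)] unfolding dot_norm by simp
  qed
  show ?thesis
    using real[OF assms(4,5)] real[OF csubspace_scaleC[OF L assms(4)] assms(5), of \<i>] assms(4)
    by (intro polarization) (simp_all add: clinear_onD(2)[OF T])
qed

text \<open>A linear map that is bounded below carries Cauchy sequences back to Cauchy sequences, so it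
  preserves completeness.\<close>

lemma closed_image_bounded_below:
  fixes T :: "'a::{complex_inner,complete_space} \<Rightarrow> 'b::{complex_inner,complete_space}"
  assumes T: "clinear_on L T" and L: "csubspace L" "closed L"
    and B: "\<And>x. x \<in> L \<Longrightarrow> norm (T x) \<le> B * norm x"
    and c: "c > 0" "\<And>x. x \<in> L \<Longrightarrow> c * norm x \<le> norm (T x)"
  shows "closed (T ` L)"
  unfolding closed_sequential_limits
proof (intro allI impI, elim conjE)
  fix y :: "nat \<Rightarrow> 'b" and l
  assume "\<forall>n. y n \<in> T ` L" and lim: "y \<longlonglongrightarrow> l"
  then have "\<forall>n. \<exists>x\<in>L. y n = T x"
    by blast
  then obtain x where x: "\<And>n. x n \<in> L" "\<And>n. y n = T (x n)"
    by metis
  have "Cauchy y"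
    using lim LIMSEQ_imp_Cauchy by blast
  have "Cauchy x"
  proof (rule metric_CauchyI)
    fix e :: real assume "e > 0"
    then obtain M where M: "\<And>m n. m \<ge> M \<Longrightarrow> n \<ge> M \<Longrightarrow> dist (y m) (y n) < c * e"
      using \<open>Cauchy y\<close> c(1) unfolding Cauchy_def by (metis mult_pos_pos)
    have "dist (x m) (x n) < e" if "m \<ge> M" "n \<ge> M" for m n
    proof -
      have "c * norm (x m - x n) \<le> norm (T (x m - x n))"
        by (intro c csubspace_diff L x)
      also have "\<dots> < c * e"
        using M[OF that] by (simp add: dist_norm x clinear_on_diff[OF T L(1)])
      finally show ?thesis
        using c(1) by (simp add: dist_norm)
    qed
    then show "\<exists>M. \<forall>m\<ge>M. \<forall>n\<ge>M. dist (x m) (x n) < e"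
      by blast
  qed
  then obtain x0 where x0: "x \<longlonglongrightarrow> x0"
    using Cauchy_convergent convergent_def by blast
  then have "x0 \<in> L"
    using L(2) x(1) closed_sequentially by blast
  have "(\<lambda>n. T (x n) - T x0) \<longlonglongrightarrow> 0"
  proof (rule Lim_null_comparison)
    show "\<forall>\<^sub>F n in sequentially. norm (T (x n) - T x0) \<le> B * norm (x n - x0)"
      using B[OF csubspace_diff[OF L(1) x(1) \<open>x0 \<in> L\<close>]] x(1) \<open>x0 \<in> L\<close>
      by (simp add: clinear_on_diff[OF T L(1)])
    show "(\<lambda>n. B * norm (x n - x0)) \<longlonglongrightarrow> 0"
      using tendsto_mult_right_zero[OF tendsto_norm_zero[OF LIM_zero[OF x0]]] by simp
  qed
  then have "(\<lambda>n. T (x n)) \<longlonglongrightarrow> T x0"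
    by (rule LIM_zero_cancel)
  moreover have "(\<lambda>n. T (x n)) = y"
    using x(2) by auto
  ultimately have "y \<longlonglongrightarrow> T x0"
    by simp
  then show "l \<in> T ` L"
    using LIMSEQ_unique[OF lim] \<open>x0 \<in> L\<close> by blast
qed

lemma ortho_projI:
  assumes "csubspace L" "p \<in> L" "x - p \<in> ortho_compl L"
  shows "ortho_proj L x = p"
  unfolding ortho_proj_def
proof (rule the_equality)
  fix q assume q: "q \<in> L \<and> x - q \<in> ortho_compl L"
  have "(x - p) - (x - q) \<in> ortho_compl L"
    by (rule csubspace_diff) (use q assms in auto)
  moreover have "q - p \<in> L"
    using q assms by (intro csubspace_diff) auto
  ultimately have "cinner (q - p) (q - p) = 0"
    by (simp add: ortho_compl_def)
  then show "q = p"
    by simp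
qed (use assms in auto)

text \<open>The nearest point of \<open>L\<close> is the projection: by the parallelogram law a minimizing sequence is
  Cauchy, and the minimizer is orthogonal because moving along any \<open>v \<in> L\<close> cannot decrease the
  distance.\<close>

lemma ortho_proj_ex:
  fixes L :: "'a::{complex_inner,complete_space} set"
  assumes L: "csubspace L" "closed L"
  shows "\<exists>p\<in>L. x - p \<in> ortho_compl L"
proof -
  define d where "d = Inf ((\<lambda>y. (norm (x - y))\<^sup>2) ` L)"
  have bdd: "bdd_below ((\<lambda>y. (norm (x - y))\<^sup>2) ` L)"
    by (rule bdd_belowI[of _ 0]) auto
  have ne: "L \<noteq> {}"
    using csubspace_0[OF L(1)] by blast
  have d_le: "d \<le> (norm (x - y))\<^sup>2" if "y \<in> L" for y
    unfolding d_def using bdd that by (auto intro: cInf_lower)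
  define k where "k n = inverse (real (Suc n))" for n
  have "\<exists>y\<in>L. (norm (x - y))\<^sup>2 < d + k n" for n
  proof -
    have "Inf ((\<lambda>y. (norm (x - y))\<^sup>2) ` L) < d + k n"
      unfolding d_def[symmetric] by (simp add: k_def)
    then show ?thesis
      using cInf_lessD ne by (metis (no_types, lifting) image_iff image_is_empty)
  qed
  then obtain y where y: "\<And>n. y n \<in> L" "\<And>n. (norm (x - y n))\<^sup>2 < d + k n"
    by metis
  have par: "(norm (u - v))\<^sup>2 \<le> 2 * ((norm (x - u))\<^sup>2 - d) + 2 * ((norm (x - v))\<^sup>2 - d)"
    if "u \<in> L" "v \<in> L" for u v
  proof -
    have "(1/2) *\<^sub>C (u + v) \<in> L"
      using L that by (intro csubspace_scaleC csubspace_add)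
    then have "4 * d \<le> 4 * (norm (x - (1/2) *\<^sub>R (u + v)))\<^sup>2"
      using d_le[of "(1/2) *\<^sub>R (u + v)"] scaleC_of_real[of "1/2" "u + v"] by simp
    also have "\<dots> = (norm (2 *\<^sub>R (x - (1/2) *\<^sub>R (u + v))))\<^sup>2"
      by (simp add: power_mult_distrib)
    also have "2 *\<^sub>R (x - (1/2) *\<^sub>R (u + v)) = (x - u) + (x - v)"
      by (simp add: algebra_simps scaleR_2)
    finally have "4 * d \<le> (norm ((x - u) + (x - v)))\<^sup>2" .
    moreover have "(norm ((x - u) + (x - v)))\<^sup>2 + (norm (u - v))\<^sup>2
        = 2 * (norm (x - u))\<^sup>2 + 2 * (norm (x - v))\<^sup>2"
      by (simp add: power2_norm_eq_inner inner_simps inner_commute algebra_simps)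
    ultimately show ?thesis
      by simp
  qed
  have "Cauchy y"
  proof (rule metric_CauchyI)
    fix e :: real assume "e > 0"
    then obtain M where M: "k M < e\<^sup>2 / 4"
      using reals_Archimedean[of "e\<^sup>2 / 4"] by (auto simp: k_def)
    have "dist (y m) (y n) < e" if "m \<ge> M" "n \<ge> M" for m n
    proof -
      have "k m \<le> k M" "k n \<le> k M"
        using that by (simp_all add: k_def le_imp_inverse_le)
      then have "(norm (y m - y n))\<^sup>2 < e\<^sup>2"
        using par[OF y(1)[of m] y(1)[of n]] y(2)[of m] y(2)[of n] M
        by (auto simp: field_simps)
      then show ?thesis
        using \<open>e > 0\<close> by (simp add: dist_norm power2_less_imp_less)
    qed
    then show "\<exists>M. \<forall>m\<ge>M. \<forall>n\<ge>M. dist (y m) (y n) < e"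
      by blast
  qed
  then obtain p where p: "y \<longlonglongrightarrow> p"
    using Cauchy_convergent convergent_def by blast
  then have "p \<in> L"
    using L(2) y(1) closed_sequentially by blast
  have "(\<lambda>n. (norm (x - y n))\<^sup>2) \<longlonglongrightarrow> (norm (x - p))\<^sup>2"
    by (intro tendsto_intros p)
  moreover have "(\<lambda>n. d + k n) \<longlonglongrightarrow> d + 0"
    unfolding k_def by (intro tendsto_intros LIMSEQ_inverse_real_of_nat)
  ultimately have "(norm (x - p))\<^sup>2 \<le> d"
    using y(2) by (intro LIMSEQ_le[of "\<lambda>n. (norm (x - y n))\<^sup>2" _ "\<lambda>n. d + k n" d])
      (simp_all add: less_imp_le)
  have "cinner (x - p) v = 0" if "v \<in> L" for v
  proof (cases "v = 0")
    case False
    define u c where "u = x - p" and "c = cinner u v"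
    define a where "a = c / (norm v)\<^sup>2"
    have nv: "(norm v)\<^sup>2 > 0"
      using False by simp
    have "cinner v u = cnj c"
      unfolding c_def by (rule cinner_commute)
    then have "cinner (u - a *\<^sub>C v) (u - a *\<^sub>C v)
        = cinner u u - cnj a * c - a * cnj c + a * cnj a * (norm v)\<^sup>2"
      unfolding cinner_diff_left cinner_diff_right cinner_scaleC_left cinner_scaleC_right
        cinner_self[of v] c_def[symmetric] by (simp add: algebra_simps)
    also have "\<dots> = cinner u u - c * cnj c / (norm v)\<^sup>2"
      using False by (simp add: a_def divide_simps power2_eq_square)
    finally have "complex_of_real ((norm (u - a *\<^sub>C v))\<^sup>2) = of_real ((norm u)\<^sup>2 - (cmod c)\<^sup>2 / (norm v)\<^sup>2)"
      unfolding cinner_self complex_norm_square[symmetric] by simp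
    then have "(norm (u - a *\<^sub>C v))\<^sup>2 = (norm u)\<^sup>2 - (cmod c)\<^sup>2 / (norm v)\<^sup>2"
      by (simp only: of_real_eq_iff)
    moreover have "d \<le> (norm (u - a *\<^sub>C v))\<^sup>2"
      using d_le[OF csubspace_add[OF L(1) \<open>p \<in> L\<close> csubspace_scaleC[OF L(1) that, of a]]]
      by (simp add: u_def algebra_simps)
    ultimately have "(cmod c)\<^sup>2 / (norm v)\<^sup>2 \<le> 0"
      using \<open>(norm (x - p))\<^sup>2 \<le> d\<close> unfolding u_def by linarith
    then show ?thesis
      using nv False by (simp add: divide_le_0_iff c_def u_def)
  qed simp
  then show ?thesis
    using \<open>p \<in> L\<close> by (auto simp: ortho_compl_def)
qed

lemma ortho_proj:
  fixes L :: "'a::{complex_inner,complete_space} set"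
  assumes L: "csubspace L" "closed L"
  shows "ortho_proj L x \<in> L" "x - ortho_proj L x \<in> ortho_compl L"
  using ortho_proj_ex[OF assms, of x] ortho_projI[OF L(1)] by metis+

lemma subset_ortho_compl_ortho_compl: "L \<subseteq> ortho_compl (ortho_compl L)"
  by (auto simp: ortho_compl_def cinner_eq_zero_commute)

lemma ortho_proj_compl:
  fixes L :: "'a::{complex_inner,complete_space} set"
  assumes L: "csubspace L" "closed L"
  shows "ortho_proj (ortho_compl L) x = x - ortho_proj L x"
  using ortho_proj[OF assms, of x] subset_ortho_compl_ortho_compl[of L]
  by (intro ortho_projI) auto

lemma ortho_proj_decomp:
  fixes L :: "'a::{complex_inner,complete_space} set"
  assumes "csubspace L" "closed L"
  shows "x = ortho_proj L x + ortho_proj (ortho_compl L) x"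
  by (simp add: ortho_proj_compl[OF assms])

lemma ortho_proj_compl_in:
  fixes L :: "'a::{complex_inner,complete_space} set"
  assumes "csubspace L" "closed L"
  shows "ortho_proj (ortho_compl L) x \<in> ortho_compl L"
  by (simp add: ortho_proj_compl[OF assms] ortho_proj[OF assms])

lemma pythagoras: "cinner x y = 0 \<Longrightarrow> (norm (x + y))\<^sup>2 = (norm x)\<^sup>2 + (norm y)\<^sup>2"
  using inner_eq_Re_cinner[of x y]
  by (simp add: power2_norm_eq_inner inner_simps inner_commute)

lemma norm_ortho_proj_sq:
  fixes L :: "'a::{complex_inner,complete_space} set"
  assumes "csubspace L" "closed L"
  shows "(norm x)\<^sup>2 = (norm (ortho_proj L x))\<^sup>2 + (norm (ortho_proj (ortho_compl L) x))\<^sup>2"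
proof -
  have "cinner (ortho_proj L x) (ortho_proj (ortho_compl L) x) = 0"
    using ortho_proj[OF assms, of x] ortho_proj_compl_in[OF assms, of x]
    by (subst cinner_eq_zero_commute) (simp add: ortho_compl_def)
  from pythagoras[OF this] show ?thesis
    using ortho_proj_decomp[OF assms, of x] by simp
qed

lemma clinear_ortho_proj:
  fixes L :: "'a::{complex_inner,complete_space} set"
  assumes "csubspace L" "closed L"
  shows "clinear_on UNIV (ortho_proj L)"
  unfolding clinear_on_def
proof (intro conjI ballI allI)
  fix x y a
  note p = ortho_proj[OF assms]
  have "(x - ortho_proj L x) + (y - ortho_proj L y) \<in> ortho_compl L"
    by (intro csubspace_add p) simp
  then show "ortho_proj L (x + y) = ortho_proj L x + ortho_proj L y"
    by (intro ortho_projI csubspace_add assms p) (simp add: algebra_simps)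
  have "a *\<^sub>C (x - ortho_proj L x) \<in> ortho_compl L"
    by (intro csubspace_scaleC p) simp
  then show "ortho_proj L (a *\<^sub>C x) = a *\<^sub>C ortho_proj L x"
    by (intro ortho_projI csubspace_scaleC assms p) (simp add: cvec.scale_right_diff_distrib)
qed

text \<open>A closed range with trivial orthogonal complement is the whole space.\<close>

lemma surj_bounded_below:
  fixes T :: "'a::{complex_inner,complete_space} \<Rightarrow> 'b::{complex_inner,complete_space}"
  assumes T: "clinear_on UNIV T" and B: "\<And>x. norm (T x) \<le> B * norm x"
    and c: "c > 0" "\<And>x. c * norm x \<le> norm (T x)"
    and dense: "\<And>y. (\<And>x. cinner (T x) y = 0) \<Longrightarrow> y = 0"
  shows "surj T"
proof -
  have "closed (range T)" "csubspace (range T)"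
    using closed_image_bounded_below[OF T] csubspace_image[OF T] B c by auto
  note p = ortho_proj[OF this(2,1)]
  have "y \<in> range T" for y
  proof -
    have "y - ortho_proj (range T) y = 0"
      using p(2)[of y] by (intro dense) (simp add: ortho_compl_def cinner_eq_zero_commute)
    then show ?thesis
      using p(1)[of y] by simp
  qed
  then show ?thesis
    by blast
qed

section \<open>Automatic boundedness\<close>

text \<open>Hellinger-Toeplitz by uniform boundedness: the functionals \<open>y \<mapsto> \<langle>T x, y\<rangle>\<close>, \<open>norm x \<le> 1\<close>, are
  bounded at each \<open>y\<close> by \<open>norm (S y)\<close>, so by Baire they are bounded by some \<open>n\<close> on a whole ball.\<close>

lemma adjoint_pair_bounded:
  fixes T S :: "'a::{complex_inner,complete_space} \<Rightarrow> 'a"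
  assumes T: "clinear_on UNIV T" and adj: "\<And>x y. cinner (T x) y = cinner x (S y)"
  shows "\<exists>B\<ge>0. \<forall>x. norm (T x) \<le> B * norm x"
proof -
  define K where "K n = (\<Inter>x\<in>cball 0 1. {y. cmod (cinner (T x) y) \<le> real n})" for n
  have cont: "continuous_on UNIV (\<lambda>y. cmod (cinner u y))" for u :: 'a
  proof -
    have "\<bar>cmod (cinner u y) - cmod (cinner u z)\<bar> \<le> norm u * dist y z" for y z
      using norm_triangle_ineq3[of "cinner u y" "cinner u z"] norm_cinner_le[of u "y - z"]
      by (simp add: cinner_diff_right dist_norm)
    then have "(norm u)-lipschitz_on UNIV (\<lambda>y. cmod (cinner u y))"
      by (intro lipschitz_onI) (auto simp: dist_norm)
    then show ?thesis
      by (rule lipschitz_on_continuous_on)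
  qed
  have "closed (K n)" for n
    unfolding K_def by (intro closed_INT ballI closed_Collect_le cont continuous_on_const)
  moreover have "(\<Union>n. K n) = UNIV"
  proof (rule set_eqI, simp)
    fix y
    obtain n :: nat where n: "norm (S y) \<le> real n"
      using real_arch_simple by blast
    have "cmod (cinner (T x) y) \<le> real n" if "norm x \<le> 1" for x
    proof -
      have "cmod (cinner (T x) y) \<le> norm x * norm (S y)"
        unfolding adj by (rule norm_cinner_le)
      also have "\<dots> \<le> 1 * norm (S y)"
        using that by (intro mult_right_mono) auto
      finally show ?thesis
        using n by simp
    qed
    then show "\<exists>n. y \<in> K n"
      unfolding K_def by (intro exI[of _ n]) simp
  qed
  ultimately have "\<exists>n. interior (K n) \<noteq> {}"
  proof -
    assume cl: "\<And>n. closed (K n)" and un: "(\<Union>n. K n) = UNIV"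
    show ?thesis
    proof (rule ccontr)
      assume "\<not> (\<exists>n. interior (K n) \<noteq> {})"
      then have "interior (\<Union>n. K n) = {}"
        using Met_TC.metric_Baire_category_alt[of "range K"] cl
        by (simp add: complete_UNIV image_iff) (metis)
      then show False
        by (simp add: un)
    qed
  qed
  then obtain n y0 where "y0 \<in> interior (K n)"
    by blast
  then obtain r where r: "r > 0" "cball y0 r \<subseteq> K n"
    by (meson mem_interior_cball)
  have bound: "norm (T x) \<le> 2 * real n / r" if "norm x \<le> 1" for x
  proof (rule norm_leI_cinner)
    show "0 \<le> 2 * real n / r"
      using r by simp
    fix y :: 'a
    show "cmod (cinner (T x) y) \<le> 2 * real n / r * norm y"
    proof (cases "y = 0")
      case False
      define v where "v = of_real (r / norm y) *\<^sub>C y"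
      have "norm v = r"
        using r False by (simp add: v_def norm_divide)
      then have "y0 + v \<in> K n" "y0 \<in> K n"
        using r by (auto simp: dist_norm)
      then have "cmod (cinner (T x) (y0 + v)) \<le> n" "cmod (cinner (T x) y0) \<le> n"
        using that by (auto simp: K_def)
      moreover have "cinner (T x) v = cinner (T x) (y0 + v) - cinner (T x) y0"
        by (simp add: cinner_add_right)
      ultimately have "cmod (cinner (T x) v) \<le> 2 * n"
        using norm_triangle_ineq4[of "cinner (T x) (y0 + v)" "cinner (T x) y0"] by simp
      then show ?thesis
        using r False by (simp add: v_def cinner_scaleC_right norm_mult norm_divide field_simps)
    qed simp
  qed
  have "norm (T x) \<le> 2 * real n / r * norm x" for x
  proof (cases "x = 0")
    case False
    define u where "u = of_real (1 / norm x) *\<^sub>C x"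
    have "norm (T u) \<le> 2 * real n / r"
      using False by (intro bound) (simp add: u_def norm_divide)
    moreover have "norm (T u) = norm (T x) / norm x"
      using clinear_onD(2)[OF T, of x] by (simp add: u_def norm_divide divide_simps)
    ultimately show ?thesis
      using False by (simp only: pos_divide_le_eq zero_less_norm_iff not_False_eq_True)
  qed (simp add: clinear_on_0[OF T])
  then show ?thesis
    using r by (intro exI[of _ "2 * real n / r"]) auto
qed

section \<open>Holomorphic functions across the unit circle\<close>

text \<open>In the coordinate \<open>z = \<zeta> exp (\<i> w)\<close> the circle becomes the real axis, where
  Morera's theorem has already been applied in the form of pasting across a line.\<close>

lemma holomorphic_paste_across_circle:
  assumes "open S" and cont: "continuous_on S f" and hol: "f holomorphic_on (S - sphere 0 1)"
  shows "f holomorphic_on S"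
proof -
  have "f field_differentiable (at \<zeta>)" if "\<zeta> \<in> S" for \<zeta>
  proof (cases "cmod \<zeta> = 1")
    case False
    have "open (S - sphere 0 1)"
      using \<open>open S\<close> by (intro open_Diff) auto
    then show ?thesis
      using hol that False holomorphic_on_imp_differentiable_at by auto
  next
    case True
    then have "\<zeta> \<noteq> 0"
      by auto
    define e where "e w = \<zeta> * exp (\<i> * w)" for w
    have cont_e: "continuous_on X e" for X
      unfolding e_def by (intro continuous_intros)
    have hol_e: "e holomorphic_on X" for X
      unfolding e_def by (intro holomorphic_intros)
    define A where "A = e -` S"
    have "open A"
      unfolding A_def using \<open>open S\<close> cont_e by (rule open_vimage)
    have norm_e: "cmod (e w) = exp (- Im w)" for w
      using True by (simp add: e_def norm_mult)
    have "(f \<circ> e) holomorphic_on A"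
    proof (rule holomorphic_on_paste_across_line[OF \<open>open A\<close>, of \<i> _ 0])
      show "(f \<circ> e) holomorphic_on A \<inter> {z. \<i> \<bullet> z < 0}"
        "(f \<circ> e) holomorphic_on A \<inter> {z. 0 < \<i> \<bullet> z}"
        by (rule holomorphic_on_compose_gen[OF hol_e hol], force simp: A_def norm_e)+
      show "continuous_on A (f \<circ> e)"
        by (intro continuous_on_compose continuous_on_subset[OF cont] cont_e) (auto simp: A_def)
    qed simp
    moreover define h where "h = (\<lambda>z. - \<i> * Ln (z / \<zeta>))"
    moreover have "h holomorphic_on (S \<inter> ball \<zeta> 1)"
      unfolding h_def
    proof (intro holomorphic_intros)
      fix z assume "z \<in> S \<inter> ball \<zeta> 1"
      then have "cmod (1 - z / \<zeta>) < 1"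
        using True \<open>\<zeta> \<noteq> 0\<close> by (simp add: dist_norm diff_divide_eq_iff norm_divide)
      then have "Re (z / \<zeta>) > 0"
        using abs_Re_le_cmod[of "1 - z / \<zeta>"] by simp
      then show "z / \<zeta> \<notin> \<real>\<^sub>\<le>\<^sub>0"
        by (auto simp: complex_nonpos_Reals_iff)
    qed (use \<open>\<zeta> \<noteq> 0\<close> in auto)
    moreover have inv_e: "e (h z) = z" if "z \<in> ball \<zeta> 1" for z
    proof -
      have "z \<noteq> 0"
        using that True by (auto simp: dist_norm)
      then show ?thesis
        using \<open>\<zeta> \<noteq> 0\<close> by (simp add: e_def h_def mult.assoc[symmetric])
    qed
    ultimately have "((f \<circ> e) \<circ> h) holomorphic_on (S \<inter> ball \<zeta> 1)"
      by (intro holomorphic_on_compose_gen[of h _ "f \<circ> e" A]) (auto simp: A_def)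
    then have "f holomorphic_on (S \<inter> ball \<zeta> 1)"
      by (rule holomorphic_transform) (use inv_e in auto)
    moreover have "open (S \<inter> ball \<zeta> 1)" "\<zeta> \<in> S \<inter> ball \<zeta> 1"
      using \<open>open S\<close> that by auto
    ultimately show ?thesis
      using holomorphic_on_imp_differentiable_at by blast
  qed
  then show ?thesis
    by (auto simp: holomorphic_on_def intro: field_differentiable_at_within)
qed

text \<open>A first-order Taylor estimate whose constant depends on \<open>f\<close> only through its bound \<open>B\<close>, which is what
  makes it uniform over families of functions.\<close>

lemma difference_quotient_estimate:
  assumes hol: "f holomorphic_on ball z r" and "r > 0" and B: "\<And>w. w \<in> ball z r \<Longrightarrow> cmod (f w) \<le> B"
    and w: "w \<in> ball z (r/2)" "w \<noteq> z"
  shows "cmod ((f w - f z) / (w - z) - deriv f z) \<le> 32 * B / r\<^sup>2 * cmod (w - z)"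
proof -
  have sub: "cball x (r/4) \<subseteq> ball z r" if "x \<in> ball z (r/2)" for x
  proof
    fix y assume "y \<in> cball x (r/4)"
    then show "y \<in> ball z r"
      using that \<open>r > 0\<close> dist_triangle[of z y x] by simp
  qed
  \<comment> \<open>Cauchy's inequality on discs of radius \<open>r/4\<close>: the constant is \<open>fact 2 * 4 ^ 2\<close>\<close>
  have d2: "cmod ((deriv ^^ 2) f x) \<le> 32 * B / r\<^sup>2" if "x \<in> ball z (r/2)" for x
  proof -
    have "cmod ((deriv ^^ 2) f x) \<le> fact 2 * B / (r/4)^2"
    proof (rule Cauchy_inequality)
      show "f holomorphic_on ball x (r/4)"
        using holomorphic_on_subset[OF hol] sub[OF that] ball_subset_cball by blast
      show "continuous_on (cball x (r/4)) f"
        using holomorphic_on_imp_continuous_on[OF holomorphic_on_subset[OF hol sub[OF that]]] .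
      show "cmod (f u) \<le> B" if "cmod (x - u) = r/4" for u
        using sub[OF \<open>x \<in> ball z (r/2)\<close>] that by (intro B) (auto simp: dist_norm)
    qed (use \<open>r > 0\<close> in simp)
    then show ?thesis
      by (simp add: power_divide)
  qed
  have "cmod ((deriv ^^ 0) f w - (\<Sum>i\<le>1. (deriv ^^ i) f z * (w - z) ^ i / fact i))
      \<le> 32 * B / r\<^sup>2 * cmod (w - z) ^ Suc 1 / fact 1"
  proof (rule complex_Taylor[of "ball z (r/2)" 1 "\<lambda>i. (deriv ^^ i) f"])
    show "((deriv ^^ i) f has_field_derivative (deriv ^^ Suc i) f x) (at x within ball z (r/2))"
      if "x \<in> ball z (r/2)" for i x
    proof -
      have "(deriv ^^ i) f holomorphic_on ball z r"
        using hol by (rule holomorphic_higher_deriv) simp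
      then have "((deriv ^^ i) f has_field_derivative deriv ((deriv ^^ i) f) x) (at x)"
        by (rule holomorphic_derivI) (use that \<open>r > 0\<close> in auto)
      then show ?thesis
        by (simp add: has_field_derivative_at_within)
    qed
    show "cmod ((deriv ^^ Suc 1) f x) \<le> 32 * B / r\<^sup>2" if "x \<in> ball z (r/2)" for x
      using d2[OF that] by (simp add: numeral_2_eq_2)
  qed (use w \<open>r > 0\<close> in auto)
  then have "cmod (f w - f z - deriv f z * (w - z)) \<le> (32 * B / r\<^sup>2 * cmod (w - z)) * cmod (w - z)"
    by (simp add: diff_diff_eq)
  moreover have "(f w - f z) / (w - z) - deriv f z = (f w - f z - deriv f z * (w - z)) / (w - z)"
    using w by (simp add: diff_divide_distrib)
  ultimately show ?thesis
    using w by (simp only: norm_divide) (subst pos_divide_le_eq, auto)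
qed

section \<open>Analytic operator functions\<close>

lemma norm_continuous_on_openD:
  assumes "norm_continuous_on S L F" "open S" "z \<in> S" "e > 0"
  shows "\<forall>\<^sub>F w in nhds z. \<forall>x\<in>L. norm (F w x - F z x) \<le> e * norm x"
proof -
  have "\<forall>\<^sub>F w in at z within S. \<forall>x\<in>L. norm (F w x - F z x) \<le> e * norm x"
    using assms(1,3,4) unfolding norm_continuous_on_def by blast
  then have "\<forall>\<^sub>F w in at z. \<forall>x\<in>L. norm (F w x - F z x) \<le> e * norm x"
    by (simp only: at_within_open[OF assms(3,2)])
  then show ?thesis
    unfolding eventually_at_filter using \<open>e > 0\<close> by (auto elim!: eventually_mono)
qed

lemma analytic_op_imp_norm_continuous:
  assumes an: "analytic_op_on S L F" and "csubspace L"
  shows "norm_continuous_on S L F"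
  unfolding norm_continuous_on_def
proof (intro conjI ballI allI impI)
  show "bounded_clinear_on L (F z)" if "z \<in> S" for z
    using an that by (simp add: analytic_op_on_def)
  fix z and e :: real assume "z \<in> S" "e > 0"
  then obtain F' where "bounded_clinear_on L F'"
    and q: "\<forall>e>0. \<forall>\<^sub>F w in at z. \<forall>x\<in>L. norm (inverse (w - z) *\<^sub>C (F w x - F z x) - F' x) \<le> e * norm x"
    using an unfolding analytic_op_on_def by blast
  then have q: "\<forall>\<^sub>F w in at z. \<forall>x\<in>L. norm (inverse (w - z) *\<^sub>C (F w x - F z x) - F' x) \<le> 1 * norm x"
    using zero_less_one by blast
  from \<open>bounded_clinear_on L F'\<close> obtain B where B: "\<And>x. x \<in> L \<Longrightarrow> norm (F' x) \<le> B * norm x"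
    by (auto simp: bounded_clinear_on_def)
  have "((\<lambda>w. cmod (w - z) * (1 + B)) \<longlongrightarrow> cmod (z - z) * (1 + B)) (at z)"
    by (intro tendsto_intros)
  then have "\<forall>\<^sub>F w in at z. cmod (w - z) * (1 + B) < e"
    using \<open>e > 0\<close> by (simp add: order_tendstoD)
  moreover have "\<forall>\<^sub>F w in at z. w \<noteq> z"
    by (simp add: eventually_at_filter)
  ultimately have "\<forall>\<^sub>F w in at z. \<forall>x\<in>L. norm (F w x - F z x) \<le> e * norm x"
    using q
  proof eventually_elim
    case (elim w)
    show ?case
    proof
      fix x assume "x \<in> L"
      have "norm (inverse (w - z) *\<^sub>C (F w x - F z x)) \<le> (1 + B) * norm x"
        using bspec[OF elim(3) \<open>x \<in> L\<close>] B[OF \<open>x \<in> L\<close>] \<open>x \<in> L\<close> norm_triangle_sub[of "inverse (w - z) *\<^sub>C (F w x - F z x)" "F' x"]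
        by (simp add: distrib_right)
      then have "norm (F w x - F z x) \<le> cmod (w - z) * ((1 + B) * norm x)"
        using elim(2) by (simp add: norm_inverse inverse_eq_divide norm_divide divide_simps mult.commute)
      also have "\<dots> \<le> e * norm x"
        using elim(1) by (simp add: mult.assoc[symmetric] mult_right_mono)
      finally show "norm (F w x - F z x) \<le> e * norm x" .
    qed
  qed
  then show "\<forall>\<^sub>F w in at z within S. \<forall>x\<in>L. norm (F w x - F z x) \<le> e * norm x"
    unfolding eventually_at_filter by (auto elim!: eventually_mono)
qed


text \<open>Second-order Cauchy estimates for the functions \<open>z \<mapsto> \<langle>F z x, y\<rangle>\<close> are uniform over unit
  vectors, so the difference quotients are Cauchy in operator norm.\<close>

lemma analytic_op_of_weakly_holomorphic:
  fixes F :: "complex \<Rightarrow> 'a::complex_inner \<Rightarrow> 'b::{complex_inner,complete_space}"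
  assumes "open S" and bcl: "\<And>z. z \<in> S \<Longrightarrow> bounded_clinear_on UNIV (F z)"
    and bdd: "\<And>z. z \<in> S \<Longrightarrow> \<exists>M. \<forall>\<^sub>F w in nhds z. \<forall>x. norm (F w x) \<le> M * norm x"
    and hol: "\<And>x y. (\<lambda>z. cinner (F z x) y) holomorphic_on S"
  shows "analytic_op_on S UNIV F"
  unfolding analytic_op_on_def
proof (intro conjI ballI bcl)
  fix z assume "z \<in> S"
  obtain M where M: "\<forall>\<^sub>F w in nhds z. \<forall>x. norm (F w x) \<le> M * norm x"
    using bdd[OF \<open>z \<in> S\<close>] by blast
  have "\<forall>\<^sub>F w in nhds z. w \<in> S"
    using \<open>open S\<close> \<open>z \<in> S\<close> by (rule eventually_nhds_in_open)
  with M have "\<forall>\<^sub>F w in nhds z. w \<in> S \<and> (\<forall>x. norm (F w x) \<le> M * norm x)"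
    by eventually_elim simp
  then obtain r where "r > 0"
    and r: "\<And>w. dist w z < r \<Longrightarrow> w \<in> S" "\<And>w x. dist w z < r \<Longrightarrow> norm (F w x) \<le> M * norm x"
    unfolding eventually_nhds_metric by blast
  have lin: "clinear_on UNIV (F w)" if "w \<in> S" for w
    using bcl[OF that] by (simp add: bounded_clinear_on_def)
  have "M * norm x \<ge> 0" for x :: 'a
    using r(2)[of z x] \<open>r > 0\<close> norm_ge_zero[of "F z x"] by (simp del: norm_ge_zero)
  define K where "K x = 32 * (M * norm x) / r\<^sup>2" for x :: 'a
  have "K x \<ge> 0" for x
    using \<open>M * norm x \<ge> 0\<close> by (simp add: K_def)
  define Q where "Q w x = inverse (w - z) *\<^sub>C (F w x - F z x)" for w x
  have Q_diff: "norm (Q w x - Q v x) \<le> K x * (cmod (w - z) + cmod (v - z))"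
    if "dist w z < r/2" "w \<noteq> z" "dist v z < r/2" "v \<noteq> z" for w v x
  proof (rule norm_leI_cinner)
    show "0 \<le> K x * (cmod (w - z) + cmod (v - z))"
      using \<open>K x \<ge> 0\<close> by simp
    fix y
    define f where "f u = cinner (F u x) y" for u
    have "f holomorphic_on ball z r"
      unfolding f_def by (rule holomorphic_on_subset[OF hol]) (use r in \<open>auto simp: dist_commute\<close>)
    moreover have "cmod (f u) \<le> M * norm x * norm y" if "u \<in> ball z r" for u
    proof -
      have "cmod (f u) \<le> norm (F u x) * norm y"
        unfolding f_def by (rule norm_cinner_le)
      also have "\<dots> \<le> M * norm x * norm y"
        using r(2) that by (intro mult_right_mono) (auto simp: dist_commute)
      finally show ?thesis .
    qed
    ultimately have est: "cmod ((f u - f z) / (u - z) - deriv f z) \<le> K x * norm y * cmod (u - z)"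
      if "dist u z < r/2" "u \<noteq> z" for u
      using difference_quotient_estimate[of f z r "M * norm x * norm y" u] \<open>r > 0\<close> that
      by (simp add: K_def dist_commute mult_ac)
    have quot: "cinner (Q u x) y = (f u - f z) / (u - z)" for u
      by (simp add: Q_def f_def cinner_scaleC_left cinner_diff_left divide_inverse mult.commute)
    have "cmod (cinner (Q w x - Q v x) y)
        = cmod (((f w - f z) / (w - z) - deriv f z) - ((f v - f z) / (v - z) - deriv f z))"
      by (simp add: cinner_diff_left quot)
    also have "\<dots> \<le> K x * norm y * cmod (w - z) + K x * norm y * cmod (v - z)"
      by (intro order_trans[OF norm_triangle_ineq4] add_mono est that)
    finally show "cmod (cinner (Q w x - Q v x) y) \<le> K x * (cmod (w - z) + cmod (v - z)) * norm y"
      by (simp add: algebra_simps)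
  qed
  \<comment> \<open>some sequence tending to \<open>z\<close>, along which the limit \<open>F'\<close> of the quotients is taken\<close>
  define \<delta> where "\<delta> n = r / 4 * inverse (real (Suc n))" for n
  have \<delta>: "0 < \<delta> n" "\<delta> n < r / 2" for n
  proof -
    show "0 < \<delta> n"
      using \<open>r > 0\<close> by (simp add: \<delta>_def)
    have "\<delta> n \<le> r / 4 * 1"
      using \<open>r > 0\<close> unfolding \<delta>_def by (intro mult_left_mono) (auto simp: field_simps)
    then show "\<delta> n < r / 2"
      using \<open>r > 0\<close> by simp
  qed
  define v where "v n = z + of_real (\<delta> n)" for n
  have v: "dist (v n) z < r/2" "v n \<noteq> z" for n
    using \<delta>[of n] by (simp_all add: v_def dist_norm)
  have "\<delta> \<longlonglongrightarrow> 0"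
    unfolding \<delta>_def by (intro tendsto_mult_right_zero LIMSEQ_inverse_real_of_nat)
  moreover have "cmod (v n - z) = \<delta> n" for n
    using \<delta>(1)[of n] by (simp add: v_def)
  ultimately have v_lim: "(\<lambda>n. cmod (v n - z)) \<longlonglongrightarrow> 0"
    by simp
  have "convergent (\<lambda>n. Q (v n) x)" for x
  proof (rule Cauchy_convergent, rule metric_CauchyI)
    fix e :: real assume "e > 0"
    have "(\<lambda>n. K x * cmod (v n - z)) \<longlonglongrightarrow> 0"
      by (intro tendsto_mult_right_zero v_lim)
    then obtain N where "\<And>n. n \<ge> N \<Longrightarrow> K x * cmod (v n - z) < e / 2"
      using \<open>e > 0\<close> order_tendstoD(2)[of _ 0 sequentially "e/2"]
      by (auto simp: eventually_sequentially)
    then have "dist (Q (v m) x) (Q (v n) x) < e" if "m \<ge> N" "n \<ge> N" for m n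
      using Q_diff[OF v v, of m x n] that
      by (simp add: dist_norm distrib_left) (smt (verit) field_sum_of_halves)
    then show "\<exists>N. \<forall>m\<ge>N. \<forall>n\<ge>N. dist (Q (v m) x) (Q (v n) x) < e"
      by blast
  qed
  then obtain F' where F': "\<And>x. (\<lambda>n. Q (v n) x) \<longlonglongrightarrow> F' x"
    unfolding convergent_def by metis
  have Q_F': "norm (Q w x - F' x) \<le> K x * cmod (w - z)" if "dist w z < r/2" "w \<noteq> z" for w x
  proof (rule LIMSEQ_le)
    show "(\<lambda>n. norm (Q w x - Q (v n) x)) \<longlonglongrightarrow> norm (Q w x - F' x)"
      by (intro tendsto_intros F')
    have "(\<lambda>n. K x * (cmod (w - z) + cmod (v n - z))) \<longlonglongrightarrow> K x * (cmod (w - z) + 0)"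
      by (intro tendsto_intros v_lim)
    then show "(\<lambda>n. K x * (cmod (w - z) + cmod (v n - z))) \<longlonglongrightarrow> K x * cmod (w - z)"
      by simp
    show "\<exists>N. \<forall>n\<ge>N. norm (Q w x - Q (v n) x) \<le> K x * (cmod (w - z) + cmod (v n - z))"
      using Q_diff[OF that v] by blast
  qed
  have v_S: "v n \<in> S" for n
    using r(1) v(1)[of n] \<open>r > 0\<close> by auto
  have Q_lin: "Q (v n) (x + y) = Q (v n) x + Q (v n) y" "Q (v n) (a *\<^sub>C x) = a *\<^sub>C Q (v n) x" for n x y a
    using clinear_onD[OF lin[OF v_S[of n]]] clinear_onD[OF lin[OF \<open>z \<in> S\<close>]]
    by (simp_all add: Q_def cvec.scale_right_diff_distrib cvec.scale_right_distrib scaleC_scaleC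
        mult.commute)
  have tendsto_scaleC: "(\<lambda>n. a *\<^sub>C X n) \<longlonglongrightarrow> a *\<^sub>C l" if "X \<longlonglongrightarrow> l" for a and X :: "nat \<Rightarrow> 'b" and l
  proof (rule LIM_zero_cancel, rule Lim_null_comparison)
    show "\<forall>\<^sub>F n in sequentially. norm (a *\<^sub>C X n - a *\<^sub>C l) \<le> cmod a * norm (X n - l)"
      by (simp flip: cvec.scale_right_diff_distrib)
    show "(\<lambda>n. cmod a * norm (X n - l)) \<longlonglongrightarrow> 0"
      by (intro tendsto_mult_right_zero tendsto_norm_zero LIM_zero that)
  qed
  have "clinear_on UNIV F'"
    unfolding clinear_on_def
  proof (intro conjI ballI allI)
    show "F' (x + y) = F' x + F' y" for x y
      using F'[of "x + y"] tendsto_add[OF F' F'] LIMSEQ_unique unfolding Q_lin by blast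
    show "F' (a *\<^sub>C x) = a *\<^sub>C F' x" for a x
      using F'[of "a *\<^sub>C x"] tendsto_scaleC[OF F'] LIMSEQ_unique unfolding Q_lin by blast
  qed
  moreover have "\<exists>B. \<forall>x. norm (F' x) \<le> B * norm x"
  proof (intro exI allI)
    fix x
    define c where "c = cmod (v 0 - z)"
    have "c > 0"
      using v(2) by (simp add: c_def)
    have "norm (Q (v 0) x) = inverse c * norm (F (v 0) x - F z x)"
      by (simp add: Q_def c_def norm_inverse)
    also have "\<dots> \<le> inverse c * (M * norm x + M * norm x)"
      using r(2)[of "v 0" x] r(2)[of z x] v(1)[of 0] \<open>r > 0\<close> \<open>c > 0\<close>
      by (intro mult_left_mono order_trans[OF norm_triangle_ineq4] add_mono) auto
    finally have "norm (F' x) \<le> inverse c * (M * norm x + M * norm x) + K x * c"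
      using Q_F'[OF v, of 0 x] norm_triangle_sub[of "F' x" "Q (v 0) x"]
      by (simp add: c_def norm_minus_commute)
    also have "\<dots> = (inverse c * (2 * M) + 32 * M / r\<^sup>2 * c) * norm x"
      by (simp add: K_def algebra_simps)
    finally show "norm (F' x) \<le> (inverse c * (2 * M) + 32 * M / r\<^sup>2 * c) * norm x" .
  qed
  moreover have "\<forall>\<^sub>F w in at z. \<forall>x\<in>UNIV. norm (inverse (w - z) *\<^sub>C (F w x - F z x) - F' x) \<le> e * norm x"
    if "e > 0" for e
  proof -
    have "((\<lambda>w. 32 * M / r\<^sup>2 * cmod (w - z)) \<longlongrightarrow> 32 * M / r\<^sup>2 * cmod (z - z)) (at z)"
      by (intro tendsto_intros)
    then have "\<forall>\<^sub>F w in at z. 32 * M / r\<^sup>2 * cmod (w - z) < e"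
      using \<open>e > 0\<close> by (simp add: order_tendstoD)
    moreover have "\<forall>\<^sub>F w in at z. dist w z < r/2 \<and> w \<noteq> z"
      unfolding eventually_at using \<open>r > 0\<close> by (intro exI[of _ "r/2"]) auto
    ultimately show ?thesis
    proof eventually_elim
      case (elim w)
      have "norm (Q w x - F' x) \<le> e * norm x" for x
      proof -
        have "norm (Q w x - F' x) \<le> (32 * M / r\<^sup>2 * cmod (w - z)) * norm x"
          using Q_F'[of w x] elim(2) by (simp add: K_def mult_ac)
        also have "\<dots> \<le> e * norm x"
          using elim(1) by (intro mult_right_mono) auto
        finally show ?thesis .
      qed
      then show ?case
        by (simp add: Q_def)
    qed
  qed
  ultimately show "\<exists>F'. bounded_clinear_on UNIV F' \<and> (\<forall>e>0. \<forall>\<^sub>F w in at z. \<forall>x\<in>UNIV.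
      norm (inverse (w - z) *\<^sub>C (F w x - F z x) - F' x) \<le> e * norm x)"
    unfolding bounded_clinear_on_def by blast
qed

lemma norm_continuous_imp_continuous_cinner:
  assumes cont: "norm_continuous_on S L F" and "x \<in> L"
  shows "continuous_on S (\<lambda>z. cinner (F z x) y)"
  unfolding continuous_on_def
proof
  fix z assume "z \<in> S"
  show "((\<lambda>w. cinner (F w x) y) \<longlongrightarrow> cinner (F z x) y) (at z within S)"
  proof (rule tendstoI)
    fix e :: real assume "e > 0"
    define d where "d = e / (2 * (norm x * norm y + 1))"
    have "norm x * norm y + 1 > 0"
      by (simp add: add_nonneg_pos)
    then have "d > 0" and d: "d * (norm x * norm y) < e"
      using \<open>e > 0\<close> by (auto simp: d_def field_simps add_pos_nonneg)
    have "\<forall>\<^sub>F w in at z within S. \<forall>x\<in>L. norm (F w x - F z x) \<le> d * norm x"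
      using cont \<open>z \<in> S\<close> \<open>d > 0\<close> by (simp add: norm_continuous_on_def)
    then show "\<forall>\<^sub>F w in at z within S. dist (cinner (F w x) y) (cinner (F z x) y) < e"
    proof eventually_elim
      case (elim w)
      have "dist (cinner (F w x) y) (cinner (F z x) y) \<le> norm (F w x - F z x) * norm y"
        using norm_cinner_le[of "F w x - F z x" y] by (simp add: dist_norm cinner_diff_left)
      also have "\<dots> \<le> (d * norm x) * norm y"
        using elim \<open>x \<in> L\<close> by (intro mult_right_mono) auto
      finally show ?case
        using d by (simp add: mult.assoc)
    qed
  qed
qed

text \<open>The functions \<open>z \<mapsto> \<langle>F z x, y\<rangle>\<close> are continuous on \<open>S\<close>, so the circle is removable for each of them
  and \<open>F\<close> is weakly holomorphic on all of \<open>S\<close>.\<close>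

lemma analytic_op_across_circle:
  fixes F :: "complex \<Rightarrow> 'a::complex_inner \<Rightarrow> 'b::{complex_inner,complete_space}"
  assumes "open S" and cont: "norm_continuous_on S UNIV F"
    and hol: "\<And>x y. (\<lambda>z. cinner (F z x) y) holomorphic_on (S - sphere 0 1)"
  shows "analytic_op_on S UNIV F"
proof (rule analytic_op_of_weakly_holomorphic)
  have bcl: "bounded_clinear_on UNIV (F z)" if "z \<in> S" for z
    using cont that by (simp add: norm_continuous_on_def)
  then show "bounded_clinear_on UNIV (F z)" if "z \<in> S" for z
    using that .
  show "\<exists>M. \<forall>\<^sub>F w in nhds z. \<forall>x. norm (F w x) \<le> M * norm x" if "z \<in> S" for z
  proof -
    obtain B where B: "\<And>x. norm (F z x) \<le> B * norm x"
      using bcl[OF \<open>z \<in> S\<close>] by (auto simp: bounded_clinear_on_def)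
    have "\<forall>\<^sub>F w in nhds z. \<forall>x\<in>UNIV. norm (F w x - F z x) \<le> 1 * norm x"
      by (rule norm_continuous_on_openD[OF cont \<open>open S\<close> that]) simp
    then have "\<forall>\<^sub>F w in nhds z. \<forall>x. norm (F w x) \<le> (B + 1) * norm x"
    proof eventually_elim
      case (elim w)
      show ?case
      proof
        fix x
        show "norm (F w x) \<le> (B + 1) * norm x"
          using bspec[OF elim, of x] B[of x] norm_triangle_sub[of "F w x" "F z x"]
          by (simp add: distrib_right)
      qed
    qed
    then show ?thesis ..
  qed
  show "(\<lambda>z. cinner (F z x) y) holomorphic_on S" for x y
  proof (rule holomorphic_paste_across_circle[OF \<open>open S\<close> _ hol])
    show "continuous_on S (\<lambda>z. cinner (F z x) y)"
      using cont by (rule norm_continuous_imp_continuous_cinner) simp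
  qed
qed (use assms in auto)

lemma norm_continuous_onI:
  assumes "\<And>z. z \<in> S \<Longrightarrow> bounded_clinear_on L (F z)"
    and "\<And>z e. z \<in> S \<Longrightarrow> e > 0 \<Longrightarrow> \<exists>d>0. \<forall>w\<in>S. dist w z < d \<longrightarrow> (\<forall>x\<in>L. norm (F w x - F z x) \<le> e * norm x)"
  shows "norm_continuous_on S L F"
  unfolding norm_continuous_on_def
proof (intro conjI ballI allI impI assms)
  fix z and e :: real assume "z \<in> S" "e > 0"
  from assms(2)[OF this] show "\<forall>\<^sub>F w in at z within S. \<forall>x\<in>L. norm (F w x - F z x) \<le> e * norm x"
    unfolding eventually_at by blast
qed

lemma norm_continuous_onD:
  assumes "norm_continuous_on S L F" "z \<in> S"
  shows "bounded_clinear_on L (F z)"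
    and "e > 0 \<Longrightarrow> \<exists>d>0. \<forall>w\<in>S. dist w z < d \<longrightarrow> (\<forall>x\<in>L. norm (F w x - F z x) \<le> e * norm x)"
proof -
  show "bounded_clinear_on L (F z)"
    using assms by (simp add: norm_continuous_on_def)
  assume "e > 0"
  then have "\<forall>\<^sub>F w in at z within S. \<forall>x\<in>L. norm (F w x - F z x) \<le> e * norm x"
    using assms by (simp add: norm_continuous_on_def)
  then obtain d where "d > 0" "\<forall>w\<in>S. w \<noteq> z \<and> dist w z < d \<longrightarrow> (\<forall>x\<in>L. norm (F w x - F z x) \<le> e * norm x)"
    unfolding eventually_at by blast
  then have "\<forall>x\<in>L. norm (F w x - F z x) \<le> e * norm x" if "w \<in> S" "dist w z < d" for w
    using that \<open>e > 0\<close> by (cases "w = z") auto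
  then show "\<exists>d>0. \<forall>w\<in>S. dist w z < d \<longrightarrow> (\<forall>x\<in>L. norm (F w x - F z x) \<le> e * norm x)"
    using \<open>d > 0\<close> by blast
qed

lemma norm_continuous_on_subset:
  "norm_continuous_on S L F \<Longrightarrow> T \<subseteq> S \<Longrightarrow> norm_continuous_on T L F"
  unfolding norm_continuous_on_def by (meson at_le filter_leD subsetD)

lemma norm_continuous_on_cong:
  assumes "norm_continuous_on S L F" "\<And>z. z \<in> S \<Longrightarrow> G z = F z"
  shows "norm_continuous_on S L G"
  using assms(2) norm_continuous_onD[OF assms(1)] by (intro norm_continuous_onI) simp_all

text \<open>Inversion is norm continuous: \<open>F w - F z = F w (G z - G w) F z\<close>, where \<open>F w\<close> stays bounded for
  \<open>w\<close> close to \<open>z\<close> because \<open>G w\<close> inherits half of the lower bound of \<open>G z\<close>.\<close>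

lemma norm_continuous_on_inverse:
  fixes G F :: "complex \<Rightarrow> 'a::complex_inner \<Rightarrow> 'a"
  assumes G: "norm_continuous_on S UNIV G"
    and inv: "\<And>z x. z \<in> S \<Longrightarrow> F z (G z x) = x" "\<And>z x. z \<in> S \<Longrightarrow> G z (F z x) = x"
    and bcl: "\<And>z. z \<in> S \<Longrightarrow> bounded_clinear_on UNIV (F z)"
  shows "norm_continuous_on S UNIV F"
proof (rule norm_continuous_onI[OF bcl])
  fix z and e :: real assume "z \<in> S" "e > 0"
  obtain B where B: "\<And>x. norm (F z x) \<le> B * norm x"
    using bcl[OF \<open>z \<in> S\<close>] by (auto simp: bounded_clinear_on_def)
  define M where "M = max B 1"
  have "M > 0"
    by (simp add: M_def)
  have M: "norm (F z x) \<le> M * norm x" for x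
    using B[of x] mult_right_mono[of B M "norm x"] by (simp add: M_def)
  define d where "d = min (1 / (2 * M)) (e / (2 * M * M))"
  have "d > 0"
    using \<open>M > 0\<close> \<open>e > 0\<close> by (simp add: d_def)
  then obtain r where "r > 0" and r: "\<And>w x. w \<in> S \<Longrightarrow> dist w z < r \<Longrightarrow> norm (G w x - G z x) \<le> d * norm x"
    using norm_continuous_onD(2)[OF G \<open>z \<in> S\<close> \<open>d > 0\<close>] by blast
  have "norm (F w y - F z y) \<le> e * norm y" if w: "w \<in> S" "dist w z < r" for w y
  proof -
    have bound: "norm x \<le> 2 * M * norm (G w x)" for x
    proof -
      have "norm x \<le> M * norm (G z x)"
        using M[of "G z x"] inv(1)[OF \<open>z \<in> S\<close>] by simp
      also have "norm (G z x) \<le> norm (G w x) + 1 / (2 * M) * norm x"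
        using r[OF w, of x] norm_triangle_sub[of "G z x" "G w x"]
          mult_right_mono[of d "1 / (2 * M)" "norm x"]
        by (simp add: d_def norm_minus_commute)
      finally show ?thesis
        using \<open>M > 0\<close> by (simp add: distrib_left)
    qed
    have lin: "clinear_on UNIV (F w)" "clinear_on UNIV (G w)"
      using bcl[OF w(1)] norm_continuous_onD(1)[OF G w(1)] by (simp_all add: bounded_clinear_on_def)
    have "G w (F w y - F z y) = G z (F z y) - G w (F z y)"
      using inv(2)[OF w(1)] inv(2)[OF \<open>z \<in> S\<close>] by (simp add: clinear_on_diff[OF lin(2)])
    then have "norm (F w y - F z y) \<le> 2 * M * norm (G w (F z y) - G z (F z y))"
      using bound[of "F w y - F z y"] by (simp add: norm_minus_commute)
    also have "\<dots> \<le> 2 * M * (d * (M * norm y))"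
      using r[OF w, of "F z y"] M[of y] \<open>M > 0\<close> \<open>d > 0\<close>
      by (intro mult_left_mono order_trans[OF r[OF w]]) auto
    also have "\<dots> \<le> 2 * M * (e / (2 * M * M) * (M * norm y))"
      using \<open>M > 0\<close> by (intro mult_left_mono mult_right_mono) (auto simp: d_def)
    also have "\<dots> = e * norm y"
      using \<open>M > 0\<close> by simp
    finally show ?thesis .
  qed
  then show "\<exists>d>0. \<forall>w\<in>S. dist w z < d \<longrightarrow> (\<forall>x\<in>UNIV. norm (F w x - F z x) \<le> e * norm x)"
    using \<open>r > 0\<close> by blast
qed

section \<open>Resolvents of contractions and of unitary operators\<close>

lemma clinear_on_resolvent:
  assumes "clinear_on L T"
  shows "clinear_on L (\<lambda>x. x - z *\<^sub>C T x)"
  using clinear_onD[OF assms]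
  by (simp add: clinear_on_def cvec.scale_right_diff_distrib cvec.scale_right_distrib scaleC_scaleC
      mult.commute)

lemma clinear_on_inv:
  assumes "clinear_on UNIV T" "bij T"
  shows "clinear_on UNIV (inv T)"
  unfolding clinear_on_def
proof (intro conjI ballI allI)
  have inv: "T (inv T x) = x" "inv T (T y) = y" for x y
    using assms(2) by (simp_all add: bij_is_surj surj_f_inv_f bij_is_inj)
  show "inv T (x + y) = inv T x + inv T y" for x y
    using inv clinear_onD(1)[OF assms(1), of "inv T x" "inv T y"] by (metis UNIV_I)
  show "inv T (a *\<^sub>C x) = a *\<^sub>C inv T x" for a x
    using inv clinear_onD(2)[OF assms(1), of "inv T x" a] by (metis UNIV_I)
qed

lemma resolvent_bounded_below:
  assumes "norm (T x) \<le> norm x"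
  shows "(1 - cmod z) * norm x \<le> norm (x - z *\<^sub>C T x)"
proof -
  have "norm x - norm (z *\<^sub>C T x) \<le> norm (x - z *\<^sub>C T x)"
    by (rule norm_triangle_ineq2)
  moreover have "norm (z *\<^sub>C T x) \<le> cmod z * norm x"
    using assms by (simp add: mult_left_mono)
  ultimately show ?thesis
    by (simp add: left_diff_distrib)
qed

lemma inj_bounded_below:
  assumes "clinear_on UNIV T" "c > 0" "\<And>x. c * norm x \<le> norm (T x)"
  shows "inj T"
proof (rule injI)
  fix x y assume "T x = T y"
  then have "c * norm (x - y) \<le> 0"
    using assms(3)[of "x - y"] clinear_on_diff[OF assms(1)] by simp
  then show "x = y"
    using \<open>c > 0\<close> by (simp add: mult_le_0_iff)
qed

lemma bij_resolvent_contraction: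
  fixes T :: "'a::{complex_inner,complete_space} \<Rightarrow> 'a"
  assumes T: "clinear_on UNIV T" "\<And>x. norm (T x) \<le> norm x" and z: "cmod z < 1"
  shows "bij (\<lambda>x. x - z *\<^sub>C T x)"
proof (rule bijI)
  show "inj (\<lambda>x. x - z *\<^sub>C T x)"
    using z resolvent_bounded_below[of T, OF T(2)]
    by (intro inj_bounded_below[where c="1 - cmod z"] clinear_on_resolvent T) auto
  have "\<exists>x. y = x - z *\<^sub>C T x" for y
  proof -
    have "dist (y + z *\<^sub>C T u) (y + z *\<^sub>C T v) \<le> cmod z * dist u v" for u v
      using T(2)[of "u - v"]
      by (simp add: dist_norm clinear_on_diff[OF T(1)] mult_left_mono flip: cvec.scale_right_diff_distrib)
    then have "\<exists>!x. y + z *\<^sub>C T x = x"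
      using z by (intro banach_fix_type[where c="cmod z"]) auto
    then show ?thesis
      by (metis add_diff_cancel_right')
  qed
  then show "surj (\<lambda>x. x - z *\<^sub>C T x)"
    by blast
qed

lemma unitary_op_norm: "unitary_op U \<Longrightarrow> norm (U x) = norm x"
  using cinner_self[of "U x"] cinner_self[of x] by (simp add: unitary_op_def flip: of_real_power)

lemma unitary_op_bij: "unitary_op U \<Longrightarrow> bij U"
  using inj_bounded_below[of U 1] unitary_op_norm[of U] by (simp add: unitary_op_def bijI)

lemma unitary_resolvent_bounded_below:
  assumes "unitary_op U"
  shows "\<bar>1 - cmod z\<bar> * norm x \<le> norm (x - z *\<^sub>C U x)"
proof -
  have "\<bar>1 - cmod z\<bar> * norm x = \<bar>(1 - cmod z) * norm x\<bar>"
    by (simp add: abs_mult)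
  also have "\<dots> = \<bar>norm x - norm (z *\<^sub>C U x)\<bar>"
    using unitary_op_norm[OF assms] by (simp add: left_diff_distrib)
  finally have "\<bar>1 - cmod z\<bar> * norm x = \<bar>norm x - norm (z *\<^sub>C U x)\<bar>" .
  then show ?thesis
    using norm_triangle_ineq3[of x "z *\<^sub>C U x"] by simp
qed

lemma bij_resolvent_unitary:
  fixes U :: "'a::{complex_inner,complete_space} \<Rightarrow> 'a"
  assumes U: "unitary_op U" and z: "cmod z \<noteq> 1"
  shows "bij (\<lambda>x. x - z *\<^sub>C U x)"
proof (cases "cmod z < 1")
  case True
  then show ?thesis
    using U unitary_op_norm[OF U] by (intro bij_resolvent_contraction) (auto simp: unitary_op_def)
next
  case False
  then have "cmod z > 1" "z \<noteq> 0"
    using z by auto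
  have lin: "clinear_on UNIV U"
    using U by (simp add: unitary_op_def)
  have inv: "U (inv U x) = x" for x
    using unitary_op_bij[OF U] by (simp add: bij_is_surj surj_f_inv_f)
  have "surj (\<lambda>x. x - inverse z *\<^sub>C inv U x)"
  proof (rule bij_is_surj, rule bij_resolvent_contraction)
    show "clinear_on UNIV (inv U)"
      using lin unitary_op_bij[OF U] by (rule clinear_on_inv)
    show "norm (inv U x) \<le> norm x" for x
      using unitary_op_norm[OF U, of "inv U x"] inv by simp
    show "cmod (inverse z) < 1"
      using \<open>cmod z > 1\<close> by (simp add: norm_inverse inverse_less_1_iff)
  qed
  have "\<exists>x. y = x - z *\<^sub>C U x" for y
  proof -
    obtain x where x: "inv U ((- inverse z) *\<^sub>C y) = x - inverse z *\<^sub>C inv U x"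
      using surjD[OF \<open>surj (\<lambda>x. x - inverse z *\<^sub>C inv U x)\<close>, of "inv U ((- inverse z) *\<^sub>C y)"]
      by blast
    have "(- inverse z) *\<^sub>C y = U x - inverse z *\<^sub>C x"
      using arg_cong[OF x, of U] by (simp add: inv clinear_on_diff[OF lin] clinear_onD(2)[OF lin])
    then have "z *\<^sub>C (- inverse z) *\<^sub>C y = z *\<^sub>C U x - x"
      using \<open>z \<noteq> 0\<close> by (simp add: cvec.scale_right_diff_distrib)
    then have "- y = z *\<^sub>C U x - x"
      using \<open>z \<noteq> 0\<close> by (simp add: scaleC_scaleC)
    then show ?thesis
      by (metis minus_diff_eq minus_minus)
  qed
  moreover have "inj (\<lambda>x. x - z *\<^sub>C U x)"
    using z unitary_resolvent_bounded_below[OF U]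
    by (intro inj_bounded_below[where c="\<bar>1 - cmod z\<bar>"] clinear_on_resolvent lin) auto
  ultimately show ?thesis
    by (intro bijI) blast+
qed

text \<open>In the expansion of \<open>\<langle>a - z T a, b - w T b\<rangle>\<close> the last term is \<open>z * cnj w\<close> times \<open>\<langle>T a, T b\<rangle>\<close>, that is,
  \<open>\<langle>a, b\<rangle>\<close>.  On the unit circle \<open>w = z\<close>, and the identity says that the resolvent has real part one
  half.\<close>

lemma isometry_resolvent_symmetry:
  assumes T: "\<And>x y. cinner (T x) (T y) = cinner x y" and "z * cnj w = 1"
    and "x = a - z *\<^sub>C T a" "y = b - w *\<^sub>C T b"
  shows "cinner a y + cinner x b = cinner x y"
proof -
  have "cinner (z *\<^sub>C T a) (w *\<^sub>C T b) = cinner a b"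
    using assms(2)
    by (simp add: cinner_scaleC_left cinner_scaleC_right T mult.assoc[symmetric] mult.commute[of "cnj w"])
  then show ?thesis
    unfolding assms(3,4) cinner_diff_left cinner_diff_right by simp
qed

locale unitary_resolvent =
  fixes U :: "'b::{complex_inner,complete_space} \<Rightarrow> 'b"
  assumes U: "unitary_op U"
begin

definition Q :: "complex \<Rightarrow> 'b \<Rightarrow> 'b"
  where "Q z = inv (\<lambda>y. y - z *\<^sub>C U y)"

lemma U_lin: "clinear_on UNIV U"
  using U by (simp add: unitary_op_def)

lemma Q_right: "cmod z \<noteq> 1 \<Longrightarrow> Q z y - z *\<^sub>C U (Q z y) = y"
  using surj_f_inv_f[OF bij_is_surj[OF bij_resolvent_unitary[OF U]], of z y] by (simp add: Q_def)

lemma Q_left: "cmod z \<noteq> 1 \<Longrightarrow> Q z (y - z *\<^sub>C U y) = y"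
  using inv_f_f[OF bij_is_inj[OF bij_resolvent_unitary[OF U]], of z y] by (simp add: Q_def)

lemma Q_lin: "cmod z \<noteq> 1 \<Longrightarrow> clinear_on UNIV (Q z)"
  unfolding Q_def by (intro clinear_on_inv bij_resolvent_unitary clinear_on_resolvent U U_lin)

lemma norm_Q_le: "cmod z \<noteq> 1 \<Longrightarrow> norm (Q z y) \<le> inverse \<bar>1 - cmod z\<bar> * norm y"
  using unitary_resolvent_bounded_below[OF U, of z "Q z y"] Q_right[of z y]
  by (simp add: divide_simps mult.commute)

lemma Q_diff:
  assumes "cmod z \<noteq> 1" "cmod w \<noteq> 1"
  shows "Q w y - Q z y = (w - z) *\<^sub>C Q w (U (Q z y))"
proof -
  have "y = (Q z y - w *\<^sub>C U (Q z y)) + (w - z) *\<^sub>C U (Q z y)"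
    using Q_right[OF assms(1), of y] by (simp add: cvec.scale_left_diff_distrib)
  then have "Q w y = Q w (Q z y - w *\<^sub>C U (Q z y)) + (w - z) *\<^sub>C Q w (U (Q z y))"
    using clinear_onD[OF Q_lin[OF assms(2)]] by (metis UNIV_I)
  then show ?thesis
    by (simp add: Q_left[OF assms(2)])
qed

lemma norm_continuous_Q: "norm_continuous_on (- sphere 0 1) UNIV Q"
proof (rule norm_continuous_onI)
  show "bounded_clinear_on UNIV (Q z)" if "z \<in> - sphere 0 1" for z
    using Q_lin[of z] norm_Q_le[of z] that unfolding bounded_clinear_on_def by fastforce
  fix z :: complex and e :: real assume "z \<in> - sphere 0 1" "e > 0"
  then have z: "cmod z \<noteq> 1"
    by simp
  define c where "c = \<bar>1 - cmod z\<bar>"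
  have "c > 0"
    using z by (simp add: c_def)
  define d where "d = min (c / 2) (e * (c / 2) * c)"
  have "norm (Q w y - Q z y) \<le> e * norm y" if "w \<in> - sphere 0 1" "dist w z < d" for w y
  proof -
    have w: "cmod w \<noteq> 1"
      using that by simp
    have "cmod (w - z) < d"
      using that by (simp add: dist_norm)
    then have "cmod (w - z) < c / 2"
      by (simp add: d_def)
    moreover have "c - \<bar>1 - cmod w\<bar> \<le> \<bar>cmod w - cmod z\<bar>"
      unfolding c_def using abs_triangle_ineq2[of "1 - cmod z" "1 - cmod w"] by simp
    ultimately have "c / 2 \<le> \<bar>1 - cmod w\<bar>"
      using norm_triangle_ineq3[of w z] by linarith
    have "norm (Q w y - Q z y) = cmod (w - z) * norm (Q w (U (Q z y)))"
      by (simp add: Q_diff[OF z w])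
    also have "\<dots> \<le> d * (inverse (c / 2) * (inverse c * norm y))"
    proof (intro mult_mono)
      have "norm (Q w (U (Q z y))) \<le> inverse \<bar>1 - cmod w\<bar> * norm (Q z y)"
        using norm_Q_le[OF w, of "U (Q z y)"] unitary_op_norm[OF U] by simp
      also have "\<dots> \<le> inverse (c / 2) * (inverse c * norm y)"
        using norm_Q_le[OF z, of y] \<open>c > 0\<close> \<open>c / 2 \<le> \<bar>1 - cmod w\<bar>\<close>
        unfolding c_def[symmetric] by (intro mult_mono le_imp_inverse_le) auto
      finally show "norm (Q w (U (Q z y))) \<le> inverse (c / 2) * (inverse c * norm y)" .
    qed (use \<open>cmod (w - z) < d\<close> \<open>c > 0\<close> \<open>e > 0\<close> in \<open>auto simp: d_def\<close>)
    also have "\<dots> \<le> (e * (c / 2) * c) * (inverse (c / 2) * (inverse c * norm y))"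
      using \<open>c > 0\<close> by (intro mult_right_mono) (auto simp: d_def)
    also have "\<dots> = e * norm y"
      using \<open>c > 0\<close> by simp
    finally show ?thesis .
  qed
  moreover have "d > 0"
    using \<open>c > 0\<close> \<open>e > 0\<close> by (simp add: d_def)
  ultimately show "\<exists>d>0. \<forall>w\<in>- sphere 0 1. dist w z < d \<longrightarrow> (\<forall>x\<in>UNIV. norm (Q w x - Q z x) \<le> e * norm x)"
    by blast
qed

lemma holomorphic_Q: "(\<lambda>z. cinner (Q z x) y) holomorphic_on (- sphere 0 1)"
proof -
  have "open (- sphere 0 1 :: complex set)"
    by auto
  have "((\<lambda>w. cinner (Q w x) y) has_field_derivative cinner (Q z (U (Q z x))) y) (at z)"
    if "z \<in> - sphere 0 1" for z
    unfolding has_field_derivative_iff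
  proof (rule Lim_transform_eventually)
    have "continuous_on (- sphere 0 1) (\<lambda>w. cinner (Q w (U (Q z x))) y)"
      using norm_continuous_Q by (rule norm_continuous_imp_continuous_cinner) simp
    then show "((\<lambda>w. cinner (Q w (U (Q z x))) y) \<longlongrightarrow> cinner (Q z (U (Q z x))) y) (at z)"
      using that \<open>open (- sphere 0 1)\<close> continuous_on_eq_continuous_at isCont_def by blast
    have "\<forall>\<^sub>F w in at z. w \<in> - sphere 0 1"
      using \<open>open (- sphere 0 1)\<close> that by (rule eventually_at_in_open')
    moreover have "\<forall>\<^sub>F w in at z. w \<noteq> z"
      by (simp add: eventually_at_filter)
    ultimately show "\<forall>\<^sub>F w in at z. cinner (Q w (U (Q z x))) y
        = (cinner (Q w x) y - cinner (Q z x) y) / (w - z)"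
    proof eventually_elim
      case (elim w)
      have "cinner (Q w x) y - cinner (Q z x) y = (w - z) * cinner (Q w (U (Q z x))) y"
        unfolding cinner_diff_left[symmetric] cinner_scaleC_left[symmetric]
        using elim that by (simp add: Q_diff)
      then show ?case
        using elim by simp
    qed
  qed
  then show ?thesis
    using \<open>open (- sphere 0 1)\<close> by (subst holomorphic_on_open) blast+
qed

lemma Q_symmetry:
  assumes "cmod z \<noteq> 1" "z * cnj w = 1"
  shows "cinner (Q z x) y + cinner x (Q w y) = cinner x y"
proof -
  have "cmod z * cmod w = 1"
    using assms(2) by (metis complex_mod_cnj norm_mult norm_one)
  then have "cmod w \<noteq> 1"
    using assms(1) by auto
  then show ?thesis
    using U assms Q_right[of z x] Q_right[of w y]
    by (intro isometry_resolvent_symmetry[of U z w]) (auto simp: unitary_op_def)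
qed

end

section \<open>Generalized resolvents\<close>

lemma norm_isometric_embedding:
  assumes "isometric_embedding J"
  shows "norm (J x) = norm x"
  using assms cinner_self[of "J x"] cinner_self[of x]
  by (simp add: isometric_embedding_def flip: of_real_power)

text \<open>A generalized resolvent is a compression of the resolvent of \<open>U\<close>; every property of it used
  below is transported through this identity.\<close>

lemma generalized_resolvent_compression:
  fixes J :: "'a::separable_chilbert \<Rightarrow> 'b::separable_chilbert"
  assumes R: "generalized_resolvent D V J U R" and z: "cmod z \<noteq> 1"
  shows "cinner (R z x) y = cinner (unitary_resolvent.Q U z (J x)) (J y)"
proof -
  interpret unitary_resolvent U
    using R by unfold_locales (simp add: generalized_resolvent_def)
  have J: "isometric_embedding J" "clinear_on UNIV J"
    using R by (simp_all add: generalized_resolvent_def isometric_embedding_def)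
  have "closed (range J)" "csubspace (range J)"
    using closed_image_bounded_below[OF J(2), of 1 1] csubspace_image[OF J(2)]
    by (auto simp: norm_isometric_embedding[OF J(1)])
  note p = ortho_proj[OF this(2,1), of "Q z (J x)"]
  have "J (R z x) = ortho_proj (range J) (Q z (J x))"
    using R z by (simp add: generalized_resolvent_def Q_def)
  then have "cinner (J (R z x)) (J y) = cinner (Q z (J x)) (J y)"
    using p(2) by (simp add: ortho_compl_def cinner_diff_left)
  then show ?thesis
    using J(1) by (simp add: isometric_embedding_def)
qed

context
  fixes D :: "'a::separable_chilbert set" and V and J :: "'a \<Rightarrow> 'b::separable_chilbert" and U R
  assumes R: "generalized_resolvent D V J U R"
begin

interpretation unitary_resolvent U
  using R by unfold_locales (simp add: generalized_resolvent_def)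

lemma J_props:
  "J (x + y) = J x + J y" "J (a *\<^sub>C x) = a *\<^sub>C J x" "norm (J x) = norm x" "cinner (J x) (J y) = cinner x y"
  using R norm_isometric_embedding[of J x]
  by (simp_all add: generalized_resolvent_def isometric_embedding_def clinear_on_def)

lemma generalized_resolvent_norm_continuous: "norm_continuous_on (- sphere 0 1) UNIV R"
proof (rule norm_continuous_onI)
  note comp = generalized_resolvent_compression[OF R]
  fix z :: complex assume z: "z \<in> - sphere 0 1"
  then have "cmod z \<noteq> 1"
    by simp
  have "clinear_on UNIV (R z)"
    unfolding clinear_on_def
  proof (intro conjI ballI allI)
    show "R z (x + y) = R z x + R z y" for x y
      by (rule cinner_eqI) (simp add: clinear_onD(1)[OF Q_lin[OF \<open>cmod z \<noteq> 1\<close>]] comp \<open>cmod z \<noteq> 1\<close> cinner_add_left J_props)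
    show "R z (a *\<^sub>C x) = a *\<^sub>C R z x" for a x
      by (rule cinner_eqI) (simp add: clinear_onD(2)[OF Q_lin[OF \<open>cmod z \<noteq> 1\<close>]] comp \<open>cmod z \<noteq> 1\<close> cinner_scaleC_left J_props)
  qed
  moreover have "norm (R z x) \<le> inverse \<bar>1 - cmod z\<bar> * norm x" for x
  proof (rule norm_leI_cinner)
    fix y
    have "cmod (cinner (R z x) y) \<le> norm (Q z (J x)) * norm (J y)"
      unfolding comp[OF \<open>cmod z \<noteq> 1\<close>] by (rule norm_cinner_le)
    also have "\<dots> \<le> (inverse \<bar>1 - cmod z\<bar> * norm x) * norm y"
      using norm_Q_le[OF \<open>cmod z \<noteq> 1\<close>, of "J x"] by (intro mult_mono) (auto simp: J_props)
    finally show "cmod (cinner (R z x) y) \<le> inverse \<bar>1 - cmod z\<bar> * norm x * norm y" .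
  qed simp
  ultimately show "bounded_clinear_on UNIV (R z)"
    unfolding bounded_clinear_on_def by blast
  fix e :: real assume "e > 0"
  then obtain d where "d > 0" and d: "\<And>w x. w \<in> - sphere 0 1 \<Longrightarrow> dist w z < d \<Longrightarrow> norm (Q w x - Q z x) \<le> e * norm x"
    using norm_continuous_onD(2)[OF norm_continuous_Q z \<open>e > 0\<close>] by blast
  have "norm (R w x - R z x) \<le> e * norm x" if "w \<in> - sphere 0 1" "dist w z < d" for w x
  proof (rule norm_leI_cinner)
    fix y
    have "cmod w \<noteq> 1"
      using that by simp
    have "cmod (cinner (R w x - R z x) y) = cmod (cinner (Q w (J x) - Q z (J x)) (J y))"
      using \<open>cmod w \<noteq> 1\<close> \<open>cmod z \<noteq> 1\<close> by (simp add: cinner_diff_left comp)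
    also have "\<dots> \<le> norm (Q w (J x) - Q z (J x)) * norm (J y)"
      by (rule norm_cinner_le)
    also have "\<dots> \<le> e * norm x * norm y"
      using d[OF that, of "J x"] \<open>e > 0\<close> by (intro mult_mono) (auto simp: J_props)
    finally show "cmod (cinner (R w x - R z x) y) \<le> e * norm x * norm y" .
  qed (use \<open>e > 0\<close> in simp)
  then show "\<exists>d>0. \<forall>w\<in>- sphere 0 1. dist w z < d \<longrightarrow> (\<forall>x\<in>UNIV. norm (R w x - R z x) \<le> e * norm x)"
    using \<open>d > 0\<close> by blast
qed

lemma generalized_resolvent_holomorphic: "(\<lambda>z. cinner (R z x) y) holomorphic_on (- sphere 0 1)"
  using holomorphic_Q[of "J x" "J y"]
  by (rule holomorphic_transform) (simp add: generalized_resolvent_compression[OF R])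

lemma generalized_resolvent_symmetry:
  assumes "cmod z \<noteq> 1" "z * cnj w = 1"
  shows "cinner (R z x) y + cinner x (R w y) = cinner x y"
proof -
  have "cmod z * cmod w = 1"
    using assms(2) by (metis complex_mod_cnj norm_mult norm_one)
  then have "cmod w \<noteq> 1"
    using assms(1) by auto
  then have "cinner x (R w y) = cinner (J x) (Q w (J y))"
    by (subst (1 2) cinner_commute) (simp add: generalized_resolvent_compression[OF R])
  then show ?thesis
    using Q_symmetry[OF assms, of "J x" "J y"] assms(1)
    by (simp add: generalized_resolvent_compression[OF R] J_props)
qed

end

section \<open>Boundary behaviour on the unit circle\<close>

text \<open>Reflection in the circle turns norm continuity from inside into norm continuity from both sides:
  for \<open>w\<close> outside, the symmetry expresses \<open>F w - F \<zeta>\<close> by the adjoint of \<open>F w' - F \<zeta>\<close>, where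
  \<open>w' = 1 / cnj w\<close> is no farther from \<open>\<zeta>\<close> than \<open>w\<close>.\<close>

lemma norm_continuous_on_reflect:
  fixes F :: "complex \<Rightarrow> 'a::complex_inner \<Rightarrow> 'a"
  assumes off: "norm_continuous_on (- sphere 0 1) UNIV F"
    and inside: "norm_continuous_on (ball 0 1 \<union> \<Delta>) UNIV F" and \<Delta>: "\<Delta> \<subseteq> sphere 0 1"
    and sym: "\<And>z w x y. cmod z > 1 \<or> z \<in> \<Delta> \<Longrightarrow> z * cnj w = 1 \<Longrightarrow>
      cinner (F z x) y + cinner x (F w y) = cinner x y"
  shows "norm_continuous_on (- sphere 0 1 \<union> \<Delta>) UNIV F"
proof (rule norm_continuous_onI)
  let ?S = "- sphere 0 1 \<union> \<Delta>"
  show "bounded_clinear_on UNIV (F z)" if "z \<in> ?S" for z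
    using that norm_continuous_onD(1)[OF off] norm_continuous_onD(1)[OF inside] by blast
  fix z and e :: real assume "z \<in> ?S" "e > 0"
  show "\<exists>d>0. \<forall>w\<in>?S. dist w z < d \<longrightarrow> (\<forall>x\<in>UNIV. norm (F w x - F z x) \<le> e * norm x)"
  proof (cases "z \<in> \<Delta>")
    case False
    then have "z \<in> - sphere 0 1"
      using \<open>z \<in> ?S\<close> by blast
    then obtain d where "d > 0" and d: "\<And>w x. w \<in> - sphere 0 1 \<Longrightarrow> dist w z < d \<Longrightarrow> norm (F w x - F z x) \<le> e * norm x"
      using norm_continuous_onD(2)[OF off _ \<open>e > 0\<close>] by blast
    have "open (- sphere 0 1 :: complex set)"
      by auto
    then obtain d' where "d' > 0" "ball z d' \<subseteq> - sphere 0 1"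
      using \<open>z \<in> - sphere 0 1\<close> openE by blast
    then show ?thesis
      using \<open>d > 0\<close> d by (intro exI[of _ "min d d'"]) (auto simp: dist_commute subset_eq)
  next
    case True
    then have "cmod z = 1"
      using \<Delta> by auto
    obtain d where "d > 0" and d: "\<And>w x. w \<in> ball 0 1 \<union> \<Delta> \<Longrightarrow> dist w z < d \<Longrightarrow> norm (F w x - F z x) \<le> e * norm x"
      using norm_continuous_onD(2)[OF inside _ \<open>e > 0\<close>, of z] True by blast
    have "norm (F w x - F z x) \<le> e * norm x" if w: "w \<in> ?S" "dist w z < d" for w x
    proof (cases "w \<in> ball 0 1 \<union> \<Delta>")
      case False
      then have "cmod w > 1"
        using w(1) by auto
      then have "w \<noteq> 0"
        by auto
      define w' where "w' = inverse (cnj w)"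
      have "w * cnj w' = 1"
        using \<open>w \<noteq> 0\<close> by (simp add: w'_def)
      have "w' \<in> ball 0 1"
        using \<open>cmod w > 1\<close> by (simp add: w'_def norm_inverse inverse_less_1_iff)
      have "z * cnj z = 1"
        using \<open>cmod z = 1\<close> by (simp add: complex_norm_square[symmetric])
      have "cmod w * cmod (w' - z) = cmod (w * cnj (w' - z))"
        by (simp only: norm_mult complex_mod_cnj)
      also have "w * cnj (w' - z) = (z - w) * cnj z"
        using \<open>w * cnj w' = 1\<close> \<open>z * cnj z = 1\<close> by (simp add: algebra_simps)
      finally have "cmod w * cmod (w' - z) = cmod (w - z)"
        using \<open>cmod z = 1\<close> by (simp add: norm_mult norm_minus_commute)
      moreover have "1 * cmod (w' - z) \<le> cmod w * cmod (w' - z)"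
        using \<open>cmod w > 1\<close> by (intro mult_right_mono) auto
      ultimately have "dist w' z < d"
        using w(2) by (simp add: dist_norm)
      show ?thesis
      proof (rule norm_leI_cinner)
        fix y
        have "cinner (F w x - F z x) y = - cinner x (F w' y - F z y)"
          using sym[of w w' x y] sym[of z z x y] \<open>cmod w > 1\<close> True \<open>w * cnj w' = 1\<close> \<open>z * cnj z = 1\<close>
          by (simp add: cinner_diff_left cinner_diff_right algebra_simps)
        then have "cmod (cinner (F w x - F z x) y) \<le> norm x * norm (F w' y - F z y)"
          using norm_cinner_le[of x "F w' y - F z y"] by simp
        also have "\<dots> \<le> norm x * (e * norm y)"
          using d[of w' y] \<open>w' \<in> ball 0 1\<close> \<open>dist w' z < d\<close> by (intro mult_left_mono) auto
        finally show "cmod (cinner (F w x - F z x) y) \<le> e * norm x * norm y"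
          by (simp add: mult_ac)
      qed (use \<open>e > 0\<close> in simp)
    qed (use d w in blast)
    then show ?thesis
      using \<open>d > 0\<close> by blast
  qed
qed

text \<open>The origin is excluded because identities involving the reflected point \<open>1 / cnj z\<close> make no sense
  there.\<close>

lemma boundary_value_eq:
  fixes g :: "complex \<Rightarrow> 'b::t2_space"
  assumes "isCont g \<zeta>" "cmod \<zeta> = 1" and "\<And>z. z \<in> ball 0 1 \<Longrightarrow> z \<noteq> 0 \<Longrightarrow> g z = c"
  shows "g \<zeta> = c"
proof (rule tendsto_unique)
  show "at \<zeta> within ball 0 1 \<noteq> bot"
    using assms(2) by (simp add: trivial_limit_within islimpt_ball)
  show "(g \<longlongrightarrow> g \<zeta>) (at \<zeta> within ball 0 1)"
    using assms(1) unfolding isCont_def by (rule tendsto_within_subset) simp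
  have "\<forall>\<^sub>F z in at \<zeta> within ball 0 1. z \<in> ball 0 1"
    by (simp add: eventually_at_filter)
  moreover have "\<forall>\<^sub>F z in at \<zeta> within ball 0 1. z \<noteq> 0"
    unfolding eventually_at using assms(2)
    by (intro exI[of _ 1]) (auto simp: dist_norm)
  ultimately have "\<forall>\<^sub>F z in at \<zeta> within ball 0 1. g z = c"
    by eventually_elim (rule assms(3))
  then show "(g \<longlongrightarrow> c) (at \<zeta> within ball 0 1)"
    by (rule tendsto_eventually)
qed

lemma real_part_half_bounded_below:
  assumes "\<And>x. cinner (T x) x + cinner x (T x) = cinner x x"
  shows "1/2 * norm x \<le> norm (T x)"
proof (cases "x = 0")
  case False
  have "(norm x)\<^sup>2 = cmod (cinner (T x) x + cinner x (T x))"
    unfolding assms by (simp add: cinner_self norm_power)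
  also have "\<dots> \<le> norm (T x) * norm x + norm x * norm (T x)"
    by (intro order_trans[OF norm_triangle_ineq] add_mono norm_cinner_le)
  finally have "norm x * norm x \<le> (2 * norm (T x)) * norm x"
    by (simp add: power2_eq_square algebra_simps)
  then show ?thesis
    using False by simp
qed simp

text \<open>An operator with real part one half is bounded below, and so is injective with closed range;
  a vector \<open>y\<close> orthogonal to its range satisfies \<open>\<langle>T y, y\<rangle> = 0\<close>.\<close>

lemma real_part_half_bij:
  fixes T :: "'a::{complex_inner,complete_space} \<Rightarrow> 'a"
  assumes T: "bounded_clinear_on UNIV T" and half: "\<And>x. cinner (T x) x + cinner x (T x) = cinner x x"
  shows "bij T"
proof (rule bijI)
  have lin: "clinear_on UNIV T"
    using T by (simp add: bounded_clinear_on_def)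
  obtain B where B: "\<And>x. norm (T x) \<le> B * norm x"
    using T by (auto simp: bounded_clinear_on_def)
  note below = real_part_half_bounded_below[of T, OF half]
  show "inj T"
    by (rule inj_bounded_below[OF lin _ below]) simp
  show "surj T"
  proof (rule surj_bounded_below[OF lin B _ below])
    fix y assume "\<And>x. cinner (T x) y = 0"
    then show "y = 0"
      using half[of y] cinner_eq_zero_commute[of "T y" y] by simp
  qed simp
qed

text \<open>A proper isometry \<open>T\<close> has the whole disc in its spectrum.  Concretely, a vector orthogonal to the
  range of \<open>T\<close>, written \<open>u - z T u\<close>, forces \<open>u\<close> to be orthogonal to the range of \<open>1 - z T\<close>.\<close>

lemma isometry_surj_if_resolvent_surj:
  fixes T :: "'a::{complex_inner,complete_space} \<Rightarrow> 'a"
  assumes T: "clinear_on UNIV T" "\<And>x y. cinner (T x) (T y) = cinner x y"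
    and z: "cmod z = 1" and surj: "surj (\<lambda>x. x - z *\<^sub>C T x)"
  shows "surj T"
proof (rule surj_bounded_below[OF T(1), of 1 1])
  have norm: "norm (T x) = norm x" for x
    using T(2)[of x x] by (simp add: cinner_self flip: of_real_power)
  show "norm (T x) \<le> 1 * norm x" "1 * norm x \<le> norm (T x)" for x
    by (simp_all add: norm)
  fix y assume y: "\<And>x. cinner (T x) y = 0"
  obtain u where u: "y = u - z *\<^sub>C T u"
    using surjD[OF surj, of y] by blast
  have zz: "z * cnj z = 1"
    using z by (simp add: complex_norm_square[symmetric])
  have "cinner (v - z *\<^sub>C T v) u = 0" for v
  proof -
    have "z * cinner (T v) y = z * cinner (T v) u - (z * cnj z) * cinner v u"
      by (simp add: u cinner_diff_right cinner_scaleC_right T right_diff_distrib mult.assoc)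
    then show ?thesis
      using y[of v] zz by (simp add: cinner_diff_left cinner_scaleC_left)
  qed
  moreover obtain v where "u = v - z *\<^sub>C T v"
    using surjD[OF surj, of u] by blast
  ultimately have "cinner u u = 0"
    by simp
  then have "u = 0"
    by simp
  then show "y = 0"
    using u clinear_on_0[OF T(1)] by simp
qed simp

section \<open>Isometric extensions of a closed isometric operator\<close>

locale closed_isometry =
  fixes D :: "'a::separable_chilbert set" and V :: "'a \<Rightarrow> 'a"
  assumes closed_isometric: "closed_isometric D V"
begin

abbreviation "N0 \<equiv> ortho_compl D"
abbreviation "Ninf \<equiv> ortho_compl (V ` D)"

lemma D: "csubspace D" "closed D"
  and V_lin: "clinear_on D V"
  and V_norm: "x \<in> D \<Longrightarrow> norm (V x) = norm x"
  using closed_isometric by (simp_all add: closed_isometric_def)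

lemma V_cinner: "x \<in> D \<Longrightarrow> y \<in> D \<Longrightarrow> cinner (V x) (V y) = cinner x y"
  by (rule isometry_on_cinner[OF V_lin D(1) V_norm])

lemma VD: "csubspace (V ` D)" "closed (V ` D)"
proof -
  show "csubspace (V ` D)"
    by (rule csubspace_image[OF V_lin D(1)])
  show "closed (V ` D)"
    by (rule closed_image_bounded_below[OF V_lin D, of 1 1]) (simp_all add: V_norm)
qed

lemma N_sp_0: "N_sp D V 0 = N0" and M_sp_0: "M_sp D V 0 = D" and N_inf: "N_inf D V = Ninf"
  by (simp_all add: N_sp_def M_sp_def N_inf_def M_inf_def)

lemmas P = ortho_proj[OF D] and P0 = ortho_proj_compl_in[OF D] and P_decomp = ortho_proj_decomp[OF D]

lemma P_D: "x \<in> D \<Longrightarrow> ortho_proj D x = x" "x \<in> D \<Longrightarrow> ortho_proj N0 x = 0"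
proof -
  show "ortho_proj D x = x" if "x \<in> D"
    using D that csubspace_0[of "N0"] by (intro ortho_projI) auto
  then show "ortho_proj N0 x = 0" if "x \<in> D"
    using that by (simp add: ortho_proj_compl[OF D])
qed

lemma P_N0: "x \<in> N0 \<Longrightarrow> ortho_proj D x = 0" "x \<in> N0 \<Longrightarrow> ortho_proj N0 x = x"
proof -
  show "ortho_proj D x = 0" if "x \<in> N0"
    using D that csubspace_0[of D] by (intro ortho_projI) auto
  then show "ortho_proj N0 x = x" if "x \<in> N0"
    using that by (simp add: ortho_proj_compl[OF D])
qed

lemma norm_P0_le: "norm (ortho_proj N0 x) \<le> norm x"
proof (rule power2_le_imp_le)
  show "(norm (ortho_proj N0 x))\<^sup>2 \<le> (norm x)\<^sup>2"
    unfolding norm_ortho_proj_sq[OF D, of x] by simp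
qed simp

lemma P0_lin: "clinear_on UNIV (ortho_proj N0)"
  unfolding clinear_on_def ortho_proj_compl[OF D]
  using clinear_onD[OF clinear_ortho_proj[OF D]] by (simp add: cvec.scale_right_diff_distrib)

lemma oplus_op_eq: "oplus_op D V c x = V (ortho_proj D x) + c (ortho_proj N0 x)"
  by (simp add: oplus_op_def N_sp_0 M_sp_0)

lemma oplus_op_lin:
  assumes "clinear_on N0 c"
  shows "clinear_on UNIV (oplus_op D V c)"
  unfolding clinear_on_def oplus_op_eq
  using clinear_onD[OF assms] clinear_onD[OF V_lin] P(1) P0
    clinear_onD[OF clinear_ortho_proj[OF D]] clinear_onD[OF P0_lin]
  by (simp add: cvec.scale_right_distrib)

lemma oplus_op_D: "clinear_on N0 c \<Longrightarrow> x \<in> D \<Longrightarrow> oplus_op D V c x = V x"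
  by (simp add: oplus_op_eq P_D clinear_on_0)

lemma oplus_op_N0: "x \<in> N0 \<Longrightarrow> oplus_op D V c x = c x"
  by (simp add: oplus_op_eq P_N0 clinear_on_0[OF V_lin D(1)])

text \<open>The ranges of the two summands are orthogonal when \<open>C\<close> maps into \<open>Ninf\<close>, which makes
  \<open>V \<oplus> C\<close> a contraction, or an isometry, together with \<open>C\<close>.\<close>

lemma norm_oplus_op:
  assumes "\<And>h. h \<in> N0 \<Longrightarrow> c h \<in> Ninf"
  shows "(norm (oplus_op D V c x))\<^sup>2 = (norm (ortho_proj D x))\<^sup>2 + (norm (c (ortho_proj N0 x)))\<^sup>2"
proof -
  have "cinner (c (ortho_proj N0 x)) (V (ortho_proj D x)) = 0"
    using assms[OF P0] P(1) by (simp add: ortho_compl_def)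
  then show ?thesis
    using P(1) unfolding oplus_op_eq
    by (subst pythagoras) (simp_all add: cinner_eq_zero_commute V_norm)
qed

lemma oplus_op_contraction:
  assumes "\<And>h. h \<in> N0 \<Longrightarrow> c h \<in> Ninf" "\<And>h. h \<in> N0 \<Longrightarrow> norm (c h) \<le> norm h"
  shows "norm (oplus_op D V c x) \<le> norm x"
proof (rule power2_le_imp_le)
  show "(norm (oplus_op D V c x))\<^sup>2 \<le> (norm x)\<^sup>2"
    using norm_oplus_op[of c x] assms(1) assms(2)[OF P0, of x] norm_ortho_proj_sq[OF D, of x]
    by (simp add: power_mono)
qed simp

lemma oplus_op_isometry:
  assumes "\<And>h. h \<in> N0 \<Longrightarrow> c h \<in> Ninf" "\<And>h. h \<in> N0 \<Longrightarrow> norm (c h) = norm h" "clinear_on N0 c"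
  shows "cinner (oplus_op D V c x) (oplus_op D V c y) = cinner x y"
proof (rule isometry_on_cinner[OF oplus_op_lin[OF assms(3)]])
  show "norm (oplus_op D V c x) = norm x" for x
  proof -
    have "(norm (oplus_op D V c x))\<^sup>2 = (norm x)\<^sup>2"
      using norm_oplus_op[of c x] assms(1) assms(2)[OF P0, of x] norm_ortho_proj_sq[OF D, of x]
      by simp
    then show ?thesis
      by simp
  qed
qed auto

lemma norm_continuous_on_oplus_op:
  assumes "norm_continuous_on S N0 c" and into: "\<And>z h. z \<in> S \<Longrightarrow> h \<in> N0 \<Longrightarrow> c z h \<in> Ninf"
    and contr: "\<And>z h. z \<in> S \<Longrightarrow> h \<in> N0 \<Longrightarrow> norm (c z h) \<le> norm h"
  shows "norm_continuous_on S UNIV (\<lambda>z. oplus_op D V (c z))"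
proof (rule norm_continuous_onI)
  fix z assume "z \<in> S"
  then show "bounded_clinear_on UNIV (oplus_op D V (c z))"
    using norm_continuous_onD(1)[OF assms(1)] oplus_op_lin[of "c z"]
      oplus_op_contraction[of "c z"] into contr
    by (auto simp: bounded_clinear_on_def intro!: exI[of _ 1])
  fix e :: real assume "e > 0"
  then obtain d where "d > 0"
    and d: "\<And>w h. w \<in> S \<Longrightarrow> dist w z < d \<Longrightarrow> h \<in> N0 \<Longrightarrow> norm (c w h - c z h) \<le> e * norm h"
    using norm_continuous_onD(2)[OF assms(1) \<open>z \<in> S\<close> \<open>e > 0\<close>] by blast
  have "norm (oplus_op D V (c w) x - oplus_op D V (c z) x) \<le> e * norm x" if "w \<in> S" "dist w z < d" for w x
  proof -
    have "norm (oplus_op D V (c w) x - oplus_op D V (c z) x) \<le> e * norm (ortho_proj N0 x)"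
      using d[OF that P0] by (simp add: oplus_op_eq)
    also have "\<dots> \<le> e * norm x"
      using norm_P0_le \<open>e > 0\<close> by (simp add: mult_left_mono)
    finally show ?thesis .
  qed
  then show "\<exists>d>0. \<forall>w\<in>S. dist w z < d \<longrightarrow>
      (\<forall>x\<in>UNIV. norm (oplus_op D V (c w) x - oplus_op D V (c z) x) \<le> e * norm x)"
    using \<open>d > 0\<close> by blast
qed

end

text \<open>At a boundary point \<open>\<zeta>\<close>, an isometric extension \<open>T\<close> of \<open>V\<close> is compared with \<open>W\<^sub>\<zeta>\<close> on the defect
  space \<open>N\<^sub>\<zeta>\<close>.\<close>

locale boundary_point = closed_isometry +
  fixes \<zeta> :: complex
  assumes \<zeta>: "cmod \<zeta> = 1"
    and regular: "regular_type_point D V (inverse \<zeta>)"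
    and proj_M: "ortho_proj (V ` D) ` M_sp D V \<zeta> = V ` D"
begin

lemma \<zeta>_props: "\<zeta> \<noteq> 0" "\<zeta> * cnj \<zeta> = 1" "inverse \<zeta> = cnj \<zeta>"
proof -
  show "\<zeta> \<noteq> 0"
    using \<zeta> by auto
  show "\<zeta> * cnj \<zeta> = 1"
    using \<zeta> by (simp add: complex_norm_square[symmetric])
  then show "inverse \<zeta> = cnj \<zeta>"
    by (rule inverse_unique)
qed

lemma N_spD: "f \<in> N_sp D V \<zeta> \<Longrightarrow> x \<in> D \<Longrightarrow> cinner f (V x) = \<zeta> * cinner f x"
proof -
  assume "f \<in> N_sp D V \<zeta>" "x \<in> D"
  then have "cinner f (x - \<zeta> *\<^sub>C V x) = 0"
    by (auto simp: N_sp_def M_sp_def ortho_compl_def)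
  then have "\<zeta> * cinner f x = (\<zeta> * cnj \<zeta>) * cinner f (V x)"
    by (simp add: cinner_diff_right cinner_scaleC_right)
  then show ?thesis
    by (simp add: \<zeta>_props)
qed

lemma N_spI:
  assumes "\<And>x. x \<in> D \<Longrightarrow> cinner f (V x) = \<zeta> * cinner f x"
  shows "f \<in> N_sp D V \<zeta>"
  using assms \<zeta>_props(2)
  by (auto simp: N_sp_def M_sp_def ortho_compl_def cinner_diff_right cinner_scaleC_right
      mult.assoc[symmetric] mult.commute[of "cnj \<zeta>"])

text \<open>For \<open>f \<in> N\<^sub>\<zeta> \<inter> D\<close> one has \<open>\<langle>f, V f\<rangle> = \<zeta> \<langle>f, f\<rangle>\<close>, the equality case of the Cauchy-Schwarz
  inequality, so \<open>V f = \<zeta>\<^sup>-\<^sup>1 f\<close>; regularity excludes this eigenvalue.\<close>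

lemma N_sp_inter_D:
  assumes "f \<in> N_sp D V \<zeta>" "f \<in> D"
  shows "f = 0"
proof -
  have "cinner f (V f) = \<zeta> * cinner f f"
    by (rule N_spD[OF assms(1,2)])
  then have "cinner (V f) f = cnj \<zeta> * cinner f f"
    by (subst cinner_commute) (simp add: cinner_self)
  with \<open>cinner f (V f) = \<zeta> * cinner f f\<close>
  have "cinner (V f - inverse \<zeta> *\<^sub>C f) (V f - inverse \<zeta> *\<^sub>C f) = 0"
    using V_cinner[OF assms(2,2)] \<zeta>_props(2)
    by (simp add: \<zeta>_props(3) cinner_diff_left cinner_diff_right cinner_scaleC_left cinner_scaleC_right
        mult.assoc[symmetric] mult.commute[of "cnj \<zeta>"])
  then have "V f - inverse \<zeta> *\<^sub>C f = V 0 - inverse \<zeta> *\<^sub>C 0"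
    using clinear_on_0[OF V_lin D(1)] by simp
  then show "f = 0"
    using regular assms(2) csubspace_0[OF D(1)] unfolding regular_type_point_def Let_def inj_on_def
    by blast
qed

lemma N_sp_csubspace: "csubspace (N_sp D V \<zeta>)"
  by (simp add: N_sp_def)

lemma N_sp_determined_by_P0:
  assumes "f \<in> N_sp D V \<zeta>" "g \<in> N_sp D V \<zeta>" "ortho_proj N0 f = ortho_proj N0 g"
  shows "f = g"
proof -
  have "f - g = ortho_proj D f - ortho_proj D g"
    using assms(3) P_decomp[of f] P_decomp[of g] by (metis add_diff_cancel_right)
  then have "f - g \<in> D"
    using csubspace_diff[OF D(1) P(1) P(1)] by simp
  then have "f - g = 0"
    using csubspace_diff[OF N_sp_csubspace assms(1,2)] by (intro N_sp_inter_D)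
  then show ?thesis
    by simp
qed

lemma W_op_eq:
  assumes "f \<in> N_sp D V \<zeta>"
  shows "W_op D V \<zeta> (ortho_proj N0 f) = inverse \<zeta> *\<^sub>C ortho_proj Ninf f"
  unfolding W_op_def N_sp_0 N_inf
proof (rule the_equality)
  fix y assume "\<exists>g\<in>N_sp D V \<zeta>. ortho_proj N0 f = ortho_proj N0 g
      \<and> y = inverse \<zeta> *\<^sub>C ortho_proj Ninf g"
  then show "y = inverse \<zeta> *\<^sub>C ortho_proj Ninf f"
    using N_sp_determined_by_P0[OF assms] by metis
qed (use assms in blast)

text \<open>The domain of \<open>W\<^sub>\<zeta>\<close> is all of \<open>N0\<close>: a vector \<open>h - d\<close> with \<open>d \<in> D\<close> lies in \<open>N\<^sub>\<zeta>\<close> exactly when the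
  projection of \<open>d - \<zeta> V d\<close> to the range of \<open>V\<close> equals that of \<open>h\<close>, and the surjectivity condition
  on \<open>M\<^sub>\<zeta>\<close> solves this for \<open>d\<close>.\<close>

lemma P0_N_sp: "ortho_proj N0 ` N_sp D V \<zeta> = N0"
proof
  show "ortho_proj N0 ` N_sp D V \<zeta> \<subseteq> N0"
    using P0 by blast
  show "N0 \<subseteq> ortho_proj N0 ` N_sp D V \<zeta>"
  proof
    fix h assume "h \<in> N0"
    have "ortho_proj (V ` D) h \<in> ortho_proj (V ` D) ` M_sp D V \<zeta>"
      unfolding proj_M by (rule ortho_proj[OF VD])
    then obtain d where "d \<in> D"
      and d: "ortho_proj (V ` D) h = ortho_proj (V ` D) (d - \<zeta> *\<^sub>C V d)"
      by (auto simp: M_sp_def)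
    have "h - d \<in> N_sp D V \<zeta>"
    proof (rule N_spI)
      fix x assume "x \<in> D"
      let ?u = "h - (d - \<zeta> *\<^sub>C V d)"
      have "?u - ortho_proj (V ` D) ?u \<in> Ninf"
        by (rule ortho_proj[OF VD])
      moreover have "ortho_proj (V ` D) ?u = 0"
        using d clinear_on_diff[OF clinear_ortho_proj[OF VD] csubspace_UNIV] by simp
      ultimately have "cinner ?u (V x) = 0"
        using \<open>x \<in> D\<close> by (simp add: ortho_compl_def)
      moreover have "cinner ?u (V x) = cinner (h - d) (V x) + \<zeta> * cinner d x"
        unfolding cinner_diff_left cinner_scaleC_left V_cinner[OF \<open>d \<in> D\<close> \<open>x \<in> D\<close>] by simp
      ultimately have "cinner (h - d) (V x) = - \<zeta> * cinner d x"
        by (simp add: add_eq_0_iff2)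
      also have "\<dots> = \<zeta> * cinner (h - d) x"
        using \<open>h \<in> N0\<close> \<open>x \<in> D\<close> by (simp add: cinner_diff_left ortho_compl_def)
      finally show "cinner (h - d) (V x) = \<zeta> * cinner (h - d) x" .
    qed
    moreover have "ortho_proj N0 (h - d) = h"
      using clinear_on_diff[OF P0_lin csubspace_UNIV] P_N0(2)[OF \<open>h \<in> N0\<close>] P_D(2)[OF \<open>d \<in> D\<close>] by simp
    ultimately show "h \<in> ortho_proj N0 ` N_sp D V \<zeta>"
      by (metis image_eqI)
  qed
qed

context
  fixes T :: "'a \<Rightarrow> 'a"
  assumes T_lin: "clinear_on UNIV T" and T_iso: "\<And>x y. cinner (T x) (T y) = cinner x y"
    and T_ext: "\<And>x. x \<in> D \<Longrightarrow> T x = V x"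
begin

lemma resolvent_in_N_inf_iff: "g - \<zeta> *\<^sub>C T g \<in> Ninf \<longleftrightarrow> g \<in> N_sp D V \<zeta>"
proof -
  have "cinner (g - \<zeta> *\<^sub>C T g) (V x) = cinner g (V x) - \<zeta> * cinner g x" if "x \<in> D" for x
    using T_iso[of g x] that by (simp add: T_ext cinner_diff_left cinner_scaleC_left)
  then show ?thesis
    using N_spD[of g] N_spI[of g] by (auto simp: ortho_compl_def)
qed

text \<open>On \<open>N\<^sub>\<zeta>\<close> the component \<open>d\<close> of \<open>f\<close> in \<open>D\<close> contributes \<open>\<zeta> V d\<close>, which is the projection of \<open>f\<close>
  to the range of \<open>V\<close>; what remains involves only \<open>T - W\<^sub>\<zeta>\<close> on \<open>N0\<close>.\<close>

lemma resolvent_on_N_sp: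
  assumes f: "f \<in> N_sp D V \<zeta>"
  defines "h \<equiv> ortho_proj N0 f"
  shows "f - \<zeta> *\<^sub>C T f = (- \<zeta>) *\<^sub>C (T h - W_op D V \<zeta> h)"
proof -
  let ?d = "ortho_proj D f"
  have "ortho_proj (V ` D) f = \<zeta> *\<^sub>C V ?d"
  proof (rule ortho_projI[OF VD(1)])
    show "\<zeta> *\<^sub>C V ?d \<in> V ` D"
      by (intro csubspace_scaleC[OF VD(1)] imageI P)
    have "cinner (f - \<zeta> *\<^sub>C V ?d) (V x) = 0" if "x \<in> D" for x
    proof -
      have "cinner (f - ?d) x = 0"
        using P(2)[of f] that by (simp add: ortho_compl_def)
      then show ?thesis
        using V_cinner[OF P(1) that] N_spD[OF f that]
        by (simp add: cinner_diff_left cinner_scaleC_left)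
    qed
    then show "f - \<zeta> *\<^sub>C V ?d \<in> Ninf"
      by (simp add: ortho_compl_def)
  qed
  then have "f - \<zeta> *\<^sub>C V ?d = ortho_proj Ninf f"
    by (simp add: ortho_proj_compl[OF VD])
  also have "\<dots> = \<zeta> *\<^sub>C W_op D V \<zeta> h"
    unfolding h_def W_op_eq[OF f] using \<zeta>_props(1) by simp
  finally have eq: "f - \<zeta> *\<^sub>C V ?d = \<zeta> *\<^sub>C W_op D V \<zeta> h" .
  have "T f = V ?d + T h"
    using clinear_onD(1)[OF T_lin, of ?d h] P_decomp[of f] T_ext[OF P(1)] by (simp add: h_def)
  then have "f - \<zeta> *\<^sub>C T f = (f - \<zeta> *\<^sub>C V ?d) - \<zeta> *\<^sub>C T h"
    by (simp add: cvec.scale_right_distrib)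
  then show ?thesis
    unfolding eq by (simp add: cvec.scale_right_diff_distrib)
qed

text \<open>By the two previous facts \<open>1 - \<zeta> T\<close> is, up to a factor, the operator \<open>T - W\<^sub>\<zeta>\<close> between the defect
  spaces; the surjectivity condition on \<open>M\<^sub>\<zeta>\<close> reduces an arbitrary right-hand side to one in \<open>Ninf\<close>.\<close>

lemma bij_resolvent_iff:
  "bij (\<lambda>x. x - \<zeta> *\<^sub>C T x) \<longleftrightarrow>
    inj_on (\<lambda>h. T h - W_op D V \<zeta> h) N0 \<and> (\<lambda>h. T h - W_op D V \<zeta> h) ` N0 = Ninf"
  (is "bij ?S \<longleftrightarrow> inj_on ?A N0 \<and> ?A ` N0 = Ninf")
proof
  have S_lin: "clinear_on UNIV ?S"
    using T_lin by (rule clinear_on_resolvent)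
  have A_S: "?A (ortho_proj N0 f) = (- inverse \<zeta>) *\<^sub>C ?S f" if "f \<in> N_sp D V \<zeta>" for f
    unfolding resolvent_on_N_sp[OF that] using \<zeta>_props(1) by (simp add: scaleC_scaleC)
  have A_in: "?A h \<in> Ninf" if "h \<in> N0" for h
  proof -
    obtain f where f: "f \<in> N_sp D V \<zeta>" "h = ortho_proj N0 f"
      using \<open>h \<in> N0\<close> P0_N_sp by blast
    have "?S f \<in> Ninf"
      using f(1) by (simp only: resolvent_in_N_inf_iff)
    then show ?thesis
      unfolding f(2) A_S[OF f(1)] by (intro csubspace_scaleC) simp
  qed
  {
    assume "bij ?S"
    have "inj_on ?A N0"
    proof (rule inj_onI)
      fix h k assume "h \<in> N0" "k \<in> N0" and eq: "?A h = ?A k"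
      then obtain f g where f: "f \<in> N_sp D V \<zeta>" "h = ortho_proj N0 f"
        and g: "g \<in> N_sp D V \<zeta>" "k = ortho_proj N0 g"
        using P0_N_sp by blast
      have "?S f = ?S g"
        unfolding resolvent_on_N_sp[OF f(1)] resolvent_on_N_sp[OF g(1)] f(2)[symmetric] g(2)[symmetric] eq ..
      then have "f = g"
        by (rule injD[OF bij_is_inj[OF \<open>bij ?S\<close>]])
      then show "h = k"
        using f g by simp
    qed
    moreover have "y \<in> ?A ` N0" if "y \<in> Ninf" for y
    proof -
      obtain f where f: "(- \<zeta>) *\<^sub>C y = ?S f"
        using surjD[OF bij_is_surj[OF \<open>bij ?S\<close>], of "(- \<zeta>) *\<^sub>C y"] by blast
      have "?S f \<in> Ninf"
        unfolding f[symmetric] using that by (intro csubspace_scaleC) simp_all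
      then have "f \<in> N_sp D V \<zeta>"
        by (simp only: resolvent_in_N_inf_iff)
      then have "?A (ortho_proj N0 f) = y"
        using A_S[of f] \<zeta>_props(1) unfolding f[symmetric] by (simp add: scaleC_scaleC)
      then show ?thesis
        using P0 by blast
    qed
    ultimately show "inj_on ?A N0 \<and> ?A ` N0 = Ninf"
      using A_in by blast
  }
  {
    assume A: "inj_on ?A N0 \<and> ?A ` N0 = Ninf"
    have "inj ?S"
    proof (rule injI)
      fix f g assume "?S f = ?S g"
      then have S0: "?S (f - g) = 0"
        using clinear_on_diff[OF S_lin csubspace_UNIV, of f g] by (simp only: UNIV_I diff_self)
      then have fg: "f - g \<in> N_sp D V \<zeta>"
        using resolvent_in_N_inf_iff[of "f - g"] csubspace_0[of "Ninf"] by simp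
      have zero: "0 \<in> N_sp D V \<zeta>"
        using N_sp_csubspace by (rule csubspace_0)
      have "?A (ortho_proj N0 (f - g)) = ?A (ortho_proj N0 0)"
        unfolding A_S[OF fg] A_S[OF zero] S0 using clinear_on_0[OF S_lin] by simp
      then have "ortho_proj N0 (f - g) = ortho_proj N0 0"
        using A P0 unfolding inj_on_def by blast
      then have "f - g = 0"
        by (rule N_sp_determined_by_P0[OF fg zero])
      then show "f = g"
        by simp
    qed
    moreover have "y \<in> range ?S" for y
    proof -
      have "ortho_proj (V ` D) y \<in> ortho_proj (V ` D) ` M_sp D V \<zeta>"
        unfolding proj_M by (rule ortho_proj[OF VD])
      then obtain x where "x \<in> D" and x: "ortho_proj (V ` D) y = ortho_proj (V ` D) (x - \<zeta> *\<^sub>C V x)"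
        by (auto simp: M_sp_def)
      then have "ortho_proj (V ` D) y = ortho_proj (V ` D) (?S x)"
        by (simp add: T_ext)
      then have "ortho_proj (V ` D) (y - ?S x) = 0"
        using clinear_on_diff[OF clinear_ortho_proj[OF VD] csubspace_UNIV] by simp
      then have "y - ?S x \<in> Ninf"
        using ortho_proj(2)[OF VD, of "y - ?S x"] by simp
      then have "(- inverse \<zeta>) *\<^sub>C (y - ?S x) \<in> Ninf"
        by (intro csubspace_scaleC) simp_all
      then have "(- inverse \<zeta>) *\<^sub>C (y - ?S x) \<in> ?A ` N0"
        using A by blast
      then obtain h where "h \<in> N0" and h: "(- inverse \<zeta>) *\<^sub>C (y - ?S x) = ?A h"
        by blast
      then obtain f where "f \<in> N_sp D V \<zeta>" "h = ortho_proj N0 f"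
        using P0_N_sp by blast
      then have "(- inverse \<zeta>) *\<^sub>C (y - ?S x) = (- inverse \<zeta>) *\<^sub>C ?S f"
        using h by (simp only: A_S)
      moreover have "- inverse \<zeta> \<noteq> 0"
        using \<zeta>_props(1) by simp
      ultimately have "y - ?S x = ?S f"
        by (simp only: cvec.scale_cancel_left) blast
      then have "y = ?S (x + f)"
        using clinear_onD(1)[OF S_lin, of x f] by (simp add: algebra_simps)
      then show ?thesis
        by blast
    qed
    ultimately show "bij ?S"
      by (intro bijI) blast+
  }
qed

end

end

section \<open>The continuation criterion\<close>

lemma open_arc_subset_sphere: "open_arc \<Delta> \<Longrightarrow> \<Delta> \<subseteq> sphere 0 1"
  by (auto simp: open_arc_def)

text \<open>Near \<open>cis t\<close> the points of the circle are \<open>cis (t + s)\<close> where \<open>s\<close> is the \<open>Arg\<close> of the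
  quotient by \<open>cis t\<close>; it is small because \<open>Arg\<close> is continuous at \<open>1\<close>.\<close>

lemma open_compl_sphere_Un_arc:
  assumes "open_arc \<Delta>"
  shows "open (- sphere 0 1 \<union> \<Delta>)"
  unfolding open_contains_ball
proof
  obtain a b :: real where \<Delta>: "\<Delta> = cis ` {a<..<b}"
    using assms by (auto simp: open_arc_def)
  fix z assume z: "z \<in> - sphere 0 1 \<union> \<Delta>"
  show "\<exists>e>0. ball z e \<subseteq> - sphere 0 1 \<union> \<Delta>"
  proof (cases "z \<in> \<Delta>")
    case False
    have "open (- sphere 0 1 :: complex set)"
      by auto
    then obtain e where "e > 0" "ball z e \<subseteq> - sphere 0 1"
      using z False openE by blast
    then show ?thesis
      by blast
  next
    case True
    then obtain t where t: "a < t" "t < b" "z = cis t"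
      by (auto simp: \<Delta>)
    have "isCont (\<lambda>w. w / z) z"
      using t(3) by (intro continuous_intros) simp_all
    moreover have "isCont Arg (z / z)"
      using t(3) by (intro continuous_at_Arg) simp
    ultimately have "isCont (\<lambda>w. Arg (w / z)) z"
      by (rule isCont_o2)
    then have "((\<lambda>w. Arg (w / z)) \<longlongrightarrow> 0) (at z)"
      using t(3) by (simp add: isCont_def Arg_1)
    moreover have "min (t - a) (b - t) > 0"
      using t by simp
    ultimately have "\<exists>e>0. \<forall>w. 0 < dist w z \<and> dist w z < e \<longrightarrow> dist (Arg (w / z)) 0 < min (t - a) (b - t)"
      unfolding Lim_at by blast
    then obtain e where "e > 0"
      and e: "\<And>w. w \<noteq> z \<Longrightarrow> dist w z < e \<Longrightarrow> \<bar>Arg (w / z)\<bar> < min (t - a) (b - t)"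
      by auto
    have "w \<in> \<Delta>" if "dist w z < e" "w \<in> sphere 0 1" for w
    proof (cases "w = z")
      case False
      define s where "s = Arg (w / z)"
      have "cmod (w / z) = 1"
        using that t(3) by (simp add: norm_divide)
      then have "cis s = w / z"
        unfolding s_def by (subst cis_Arg) (auto simp: sgn_eq)
      then have "w = cis (t + s)"
        by (simp add: t(3) cis_mult[symmetric])
      moreover have "t + s \<in> {a<..<b}"
        using e[OF False that(1)] by (auto simp: s_def abs_less_iff)
      ultimately show ?thesis
        unfolding \<Delta> by blast
    qed (use True in simp)
    then have "ball z e \<subseteq> - sphere 0 1 \<union> \<Delta>"
      by (auto simp: dist_commute)
    then show ?thesis
      using \<open>e > 0\<close> by blast
  qed
qed

lemma inin_corresponds_resolvent:
  assumes "closed_isometric D V" "inin_corresponds D V R C" and z: "cmod z < 1"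
  defines "T \<equiv> oplus_op D V (C z)"
  shows "bij (\<lambda>x. x - z *\<^sub>C T x)" "R z = inv (\<lambda>x. x - z *\<^sub>C T x)"
    "norm (T x) \<le> norm x" "clinear_on UNIV T" "clinear_on (ortho_compl D) (C z)"
    "h \<in> ortho_compl D \<Longrightarrow> C z h \<in> ortho_compl (V ` D)"
    "h \<in> ortho_compl D \<Longrightarrow> norm (C z h) \<le> norm h"
proof -
  interpret closed_isometry D V
    by unfold_locales (rule assms(1))
  show C: "C z h \<in> Ninf" "norm (C z h) \<le> norm h" if "h \<in> N0" for h
    using assms(2) z that by (simp_all add: inin_corresponds_def schur_class_def N_sp_0 N_inf)
  show C_lin: "clinear_on N0 (C z)"
    using assms(2) z
    by (simp add: inin_corresponds_def schur_class_def analytic_op_on_def bounded_clinear_on_def N_sp_0)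
  show T: "clinear_on UNIV T" "norm (T x) \<le> norm x" for x
    unfolding T_def using C by (auto intro: oplus_op_lin[OF C_lin] oplus_op_contraction)
  show "bij (\<lambda>x. x - z *\<^sub>C T x)"
    using T z by (rule bij_resolvent_contraction)
  show "R z = inv (\<lambda>x. x - z *\<^sub>C T x)"
    using assms(2) z by (simp add: inin_corresponds_def T_def)
qed

definition admissible_boundary_values ::
    "'a::complex_inner set \<Rightarrow> ('a \<Rightarrow> 'a) \<Rightarrow> complex set \<Rightarrow> (complex \<Rightarrow> 'a \<Rightarrow> 'a) \<Rightarrow>
      (complex \<Rightarrow> 'a \<Rightarrow> 'a) \<Rightarrow> bool"
  where "admissible_boundary_values D V \<Delta> C C' \<longleftrightarrow>
    (\<forall>l\<in>ball 0 1. \<forall>x\<in>N_sp D V 0. C' l x = C l x) \<and>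
    norm_continuous_on (ball 0 1 \<union> \<Delta>) (N_sp D V 0) C' \<and>
    (\<forall>l\<in>\<Delta>. (\<forall>x\<in>N_sp D V 0. norm (C' l x) = norm x) \<and> C' l ` N_sp D V 0 = N_inf D V) \<and>
    (\<forall>l\<in>\<Delta>. inj_on (\<lambda>x. C' l x - W_op D V l x) (N_sp D V 0) \<and>
      (\<lambda>x. C' l x - W_op D V l x) ` N_sp D V 0 = N_inf D V)"

context
  fixes D :: "'a::separable_chilbert set" and V and \<Delta> and J :: "'a \<Rightarrow> 'b::separable_chilbert"
    and U and R C :: "complex \<Rightarrow> 'a \<Rightarrow> 'a"
  assumes V: "closed_isometric D V" and arc: "open_arc \<Delta>"
    and reg: "\<And>\<zeta>. \<zeta> \<in> \<Delta> \<Longrightarrow> regular_type_point D V (inverse \<zeta>)"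
    and proj: "\<And>\<zeta>. \<zeta> \<in> \<Delta> \<Longrightarrow> ortho_proj (V ` D) ` M_sp D V \<zeta> = V ` D"
    and R: "generalized_resolvent D V J U R" and C: "inin_corresponds D V R C"
begin

interpretation closed_isometry D V
  by unfold_locales (rule V)

lemma arc_boundary_point: "\<zeta> \<in> \<Delta> \<Longrightarrow> boundary_point D V \<zeta>"
  using open_arc_subset_sphere[OF arc] reg proj by unfold_locales auto

lemmas inin = inin_corresponds_resolvent[OF V C]

text \<open>The extension \<open>T\<close> built from \<open>C'\<close> is isometric on the arc, so the comparison with \<open>W\<close> makes
  \<open>1 - z T\<close> bijective there, and the symmetry of its inverse makes the inverse bounded.  The inverses then continue \<open>R\<close> norm
  continuously to the arc from inside, hence by reflection from both sides, hence analytically.\<close>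

lemma continuation_from_boundary_values:
  assumes "admissible_boundary_values D V \<Delta> C C'"
  shows "has_analytic_continuation R \<Delta>"
proof -
  let ?X = "ball 0 1 \<union> \<Delta>" and ?\<Omega> = "- sphere 0 1 \<union> \<Delta>"
  note \<Delta> = open_arc_subset_sphere[OF arc]
  note adm = assms[unfolded admissible_boundary_values_def N_sp_0 N_inf]
  have C'_cont: "norm_continuous_on ?X N0 C'"
    using adm by blast
  have C'_ball: "C' z h = C z h" if "z \<in> ball 0 1" "h \<in> N0" for z h
    using adm that by blast
  have C'_iso: "norm (C' z h) = norm h" if "z \<in> \<Delta>" "h \<in> N0" for z h
    using adm that by blast
  have C'_onto: "C' z ` N0 = Ninf" if "z \<in> \<Delta>" for z
    using adm that by blast
  have C'_W: "inj_on (\<lambda>x. C' z x - W_op D V z x) N0 \<and> (\<lambda>x. C' z x - W_op D V z x) ` N0 = Ninf"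
    if "z \<in> \<Delta>" for z
    using adm that by blast
  have C'_lin: "clinear_on N0 (C' z)" if "z \<in> ?X" for z
    using norm_continuous_onD(1)[OF C'_cont that] by (simp add: bounded_clinear_on_def)
  have C'_into: "C' z h \<in> Ninf" if "z \<in> ?X" "h \<in> N0" for z h
    using that inin(6)[of z h] C'_ball[of z h] C'_onto[of z] by auto
  have C'_contr: "norm (C' z h) \<le> norm h" if "z \<in> ?X" "h \<in> N0" for z h
    using that inin(7)[of z h] C'_ball[of z h] C'_iso[of z h] by auto
  define T where "T z = oplus_op D V (C' z)" for z
  have T_lin: "clinear_on UNIV (T z)" if "z \<in> ?X" for z
    unfolding T_def by (rule oplus_op_lin[OF C'_lin[OF that]])
  have T_contr: "norm (T z x) \<le> norm x" if "z \<in> ?X" for z x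
    unfolding T_def using C'_into C'_contr that by (intro oplus_op_contraction) auto
  have T_ball: "T z = oplus_op D V (C z)" if "z \<in> ball 0 1" for z
    by (rule ext) (simp add: T_def oplus_op_eq C'_ball[OF that P0])
  have T_iso: "cinner (T z x) (T z y) = cinner x y" if "z \<in> \<Delta>" for z x y
    unfolding T_def using C'_into C'_iso C'_lin that by (intro oplus_op_isometry) auto
  have T_cont: "norm_continuous_on ?X UNIV T"
    unfolding T_def by (intro norm_continuous_on_oplus_op C'_cont C'_into C'_contr)
  define G where "G z x = x - z *\<^sub>C T z x" for z x
  have G_lin: "clinear_on UNIV (G z)" if "z \<in> ?X" for z
    unfolding G_def by (rule clinear_on_resolvent[OF T_lin[OF that]])
  have norm_le_1: "cmod z \<le> 1" if "z \<in> ?X" for z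
    using that \<Delta> by auto
  have G_cont: "norm_continuous_on ?X UNIV G"
  proof (rule norm_continuous_onI)
    fix z assume "z \<in> ?X"
    have "norm (G z x) \<le> 2 * norm x" for x
    proof -
      have "cmod z * norm (T z x) \<le> 1 * norm x"
        using norm_le_1[OF \<open>z \<in> ?X\<close>] T_contr[OF \<open>z \<in> ?X\<close>] by (intro mult_mono) auto
      then show ?thesis
        using norm_triangle_ineq4[of x "z *\<^sub>C T z x"] by (simp add: G_def)
    qed
    then show "bounded_clinear_on UNIV (G z)"
      using G_lin[OF \<open>z \<in> ?X\<close>] unfolding bounded_clinear_on_def by blast
    fix e :: real assume "e > 0"
    then have "e / 2 > 0"
      by simp
    then obtain d where "d > 0" and d: "\<And>w x. w \<in> ?X \<Longrightarrow> dist w z < d \<Longrightarrow> norm (T w x - T z x) \<le> e / 2 * norm x"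
      using norm_continuous_onD(2)[OF T_cont \<open>z \<in> ?X\<close>] by blast
    have "norm (G w x - G z x) \<le> e * norm x" if "w \<in> ?X" "dist w z < min d (e / 2)" for w x
    proof -
      \<comment> \<open>split so that each term uses an available bound: \<open>T w\<close> is a contraction, \<open>cmod z \<le> 1\<close>\<close>
      have "G w x - G z x = (z - w) *\<^sub>C T w x + (- z) *\<^sub>C (T w x - T z x)"
        by (simp add: G_def cvec.scale_left_diff_distrib cvec.scale_right_diff_distrib)
      then have "norm (G w x - G z x) \<le> cmod (z - w) * norm (T w x) + cmod z * norm (T w x - T z x)"
        using norm_triangle_ineq[of "(z - w) *\<^sub>C T w x" "(- z) *\<^sub>C (T w x - T z x)"] by simp
      also have "\<dots> \<le> e / 2 * norm x + 1 * (e / 2 * norm x)"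
        using that T_contr[OF that(1)] norm_le_1[OF \<open>z \<in> ?X\<close>] d[OF that(1)] \<open>e > 0\<close>
        by (intro add_mono mult_mono) (auto simp: dist_norm norm_minus_commute)
      finally show ?thesis
        by simp
    qed
    then show "\<exists>d>0. \<forall>w\<in>?X. dist w z < d \<longrightarrow> (\<forall>x\<in>UNIV. norm (G w x - G z x) \<le> e * norm x)"
      using \<open>d > 0\<close> \<open>e > 0\<close> by (intro exI[of _ "min d (e / 2)"]) auto
  qed
  have G_bij: "bij (G z)" if "z \<in> ?X" for z
  proof (cases "z \<in> \<Delta>")
    case True
    interpret boundary_point D V z
      by (rule arc_boundary_point[OF True])
    have eq: "T z h - W_op D V z h = C' z h - W_op D V z h" if "h \<in> N0" for h
      by (simp add: T_def oplus_op_N0[OF that])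
    have "bij (\<lambda>x. x - z *\<^sub>C T z x) \<longleftrightarrow>
        inj_on (\<lambda>x. T z x - W_op D V z x) N0 \<and> (\<lambda>x. T z x - W_op D V z x) ` N0 = Ninf"
    proof (rule bij_resolvent_iff)
      show "T z x = V x" if "x \<in> D" for x
        unfolding T_def using C'_lin[of z] True that by (intro oplus_op_D) auto
    qed (use True T_lin T_iso in auto)
    also have "\<dots>"
      using C'_W[OF True] eq by (simp cong: inj_on_cong image_cong)
    finally show ?thesis
      unfolding G_def .
  next
    case False
    then have "z \<in> ball 0 1"
      using that by blast
    then show ?thesis
      unfolding G_def T_ball[OF \<open>z \<in> ball 0 1\<close>] using inin(1)[of z] by simp
  qed
  define F where "F z = (if z \<in> \<Delta> then inv (G z) else R z)" for z
  have F_eq: "F z = inv (G z)" if "z \<in> ?X" for z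
  proof (cases "z \<in> \<Delta>")
    case False
    then have "z \<in> ball 0 1"
      using that by blast
    then show ?thesis
      using False inin(2)[of z] unfolding F_def G_def T_ball[OF \<open>z \<in> ball 0 1\<close>] by simp
  qed (simp add: F_def)
  have F_R: "F z = R z" if "z \<in> - sphere 0 1" for z
    using that \<Delta> by (auto simp: F_def)
  have GF: "F z (G z x) = x" "G z (F z x) = x" if "z \<in> ?X" for z x
    using G_bij[OF that] by (simp_all add: F_eq[OF that] bij_is_surj surj_f_inv_f bij_is_inj)
  have sym: "cinner (F z x) y + cinner x (F w y) = cinner x y"
    if "cmod z > 1 \<or> z \<in> \<Delta>" "z * cnj w = 1" for z w x y
    using that(1)
  proof
    assume "cmod z > 1"
    have "cmod z * cmod w = 1"
      using that(2) by (metis complex_mod_cnj norm_mult norm_one)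
    then have "cmod w \<noteq> 1"
      using \<open>cmod z > 1\<close> by auto
    then show ?thesis
      using generalized_resolvent_symmetry[OF R _ that(2), of x y] \<open>cmod z > 1\<close> F_R[of z] F_R[of w] by auto
  next
    assume "z \<in> \<Delta>"
    then have "z * cnj z = 1" "z \<noteq> 0"
      using \<Delta> by (auto simp: complex_norm_square[symmetric])
    then have "cnj z = cnj w"
      using that(2) by (metis mult_left_cancel)
    then have "w = z"
      by simp
    then show ?thesis
      using T_iso[OF \<open>z \<in> \<Delta>\<close>] that(2) GF(2)[of z x] GF(2)[of z y] \<open>z \<in> \<Delta>\<close>
      by (intro isometry_resolvent_symmetry[of "T z" z w]) (auto simp: G_def)
  qed
  have "bounded_clinear_on UNIV (F z)" if "z \<in> ?X" for z
  proof (cases "z \<in> \<Delta>")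
    case True
    have F_lin: "clinear_on UNIV (F z)"
      unfolding F_eq[OF that] by (rule clinear_on_inv[OF G_lin G_bij]) (fact that)+
    have "z * cnj z = 1"
      using True \<Delta> by (auto simp: complex_norm_square[symmetric])
    then have "cinner (F z x) y = cinner x (y - F z y)" for x y
      using sym[of z z x y] True by (simp add: cinner_diff_right algebra_simps)
    then show ?thesis
      using adjoint_pair_bounded[OF F_lin, of "\<lambda>y. y - F z y"] F_lin unfolding bounded_clinear_on_def by blast
  next
    case False
    then show ?thesis
      using that norm_continuous_onD(1)[OF generalized_resolvent_norm_continuous[OF R], of z] F_R[of z] by auto
  qed
  then have "norm_continuous_on ?X UNIV F"
    using GF by (intro norm_continuous_on_inverse[OF G_cont]) auto
  moreover have "norm_continuous_on (- sphere 0 1) UNIV F"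
    using generalized_resolvent_norm_continuous[OF R] F_R by (rule norm_continuous_on_cong)
  ultimately have "norm_continuous_on ?\<Omega> UNIV F"
    using \<Delta> sym by (intro norm_continuous_on_reflect)
  moreover have "(\<lambda>z. cinner (F z x) y) holomorphic_on (?\<Omega> - sphere 0 1)" for x y
  proof -
    have "(\<lambda>z. cinner (F z x) y) holomorphic_on (- sphere 0 1)"
      using generalized_resolvent_holomorphic[OF R, of x y] by (rule holomorphic_transform) (simp add: F_R)
    then show ?thesis
      by (rule holomorphic_on_subset) blast
  qed
  ultimately have "analytic_op_on ?\<Omega> UNIV F"
    using open_compl_sphere_Un_arc[OF arc] by (intro analytic_op_across_circle)
  then show ?thesis
    using F_R unfolding has_analytic_continuation_def by blast
qed

text \<open>In the limit the continuation \<open>F\<close> has real part one half on the arc, so it is invertible, and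
  \<open>z\<^sup>-\<^sup>1 (1 - F\<^sup>-\<^sup>1)\<close>, a Cayley transform, is an isometry; it extends \<open>V\<close> and supplies \<open>C'\<close>.\<close>

lemma boundary_values_from_continuation:
  assumes "has_analytic_continuation R \<Delta>"
  shows "\<exists>C'. admissible_boundary_values D V \<Delta> C C'"
proof -
  let ?X = "ball 0 1 \<union> \<Delta>" and ?\<Omega> = "- sphere 0 1 \<union> \<Delta>"
  note \<Delta> = open_arc_subset_sphere[OF arc]
  have "open ?\<Omega>"
    by (rule open_compl_sphere_Un_arc[OF arc])
  obtain F where an: "analytic_op_on ?\<Omega> UNIV F" and F_R: "\<And>z. z \<in> - sphere 0 1 \<Longrightarrow> F z = R z"
    using assms unfolding has_analytic_continuation_def by blast
  have F_cont: "norm_continuous_on ?\<Omega> UNIV F"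
    using an csubspace_UNIV by (rule analytic_op_imp_norm_continuous)
  have F_bcl: "bounded_clinear_on UNIV (F z)" if "z \<in> ?\<Omega>" for z
    by (rule norm_continuous_onD(1)[OF F_cont that])
  have F_isCont: "isCont (\<lambda>z. cinner (F z x) y) \<zeta>" if "\<zeta> \<in> \<Delta>" for x y \<zeta>
  proof -
    have "continuous_on ?\<Omega> (\<lambda>z. cinner (F z x) y)"
      using F_cont by (rule norm_continuous_imp_continuous_cinner) simp
    then show ?thesis
      using \<open>open ?\<Omega>\<close> that continuous_on_eq_continuous_at by blast
  qed
  have \<Delta>_props: "\<zeta> * cnj \<zeta> = 1" "\<zeta> \<noteq> 0" "inverse (cnj \<zeta>) = \<zeta>" "cmod \<zeta> = 1" "\<zeta> \<notin> ball 0 1"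
    if "\<zeta> \<in> \<Delta>" for \<zeta>
  proof -
    show "cmod \<zeta> = 1" "\<zeta> \<notin> ball 0 1" "\<zeta> \<noteq> 0"
      using that \<Delta> by auto
    then show "\<zeta> * cnj \<zeta> = 1"
      by (simp add: complex_norm_square[symmetric])
    then show "inverse (cnj \<zeta>) = \<zeta>"
      by (metis inverse_unique mult.commute)
  qed
  have sym: "cinner (F \<zeta> x) y + cinner x (F \<zeta> y) = cinner x y" if "\<zeta> \<in> \<Delta>" for \<zeta> x y
  proof -
    define g where "g z = cinner (F z x) y + cnj (cinner (F (inverse (cnj z)) y) x)" for z
    have "isCont (\<lambda>z. inverse (cnj z)) \<zeta>"
      using \<Delta>_props(2)[OF that] by (intro continuous_intros) auto
    then have "isCont (\<lambda>z. cinner (F (inverse (cnj z)) y) x) \<zeta>"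
      by (rule isCont_o2) (simp add: \<Delta>_props(3)[OF that] F_isCont[OF that])
    then have "isCont g \<zeta>"
      unfolding g_def using F_isCont[OF that] by (intro continuous_intros)
    moreover have "g z = cinner x y" if "z \<in> ball 0 1" "z \<noteq> 0" for z
    proof -
      have "cmod (inverse (cnj z)) > 1"
        using that by (simp add: norm_inverse one_less_inverse)
      then have "g z = cinner (R z x) y + cinner x (R (inverse (cnj z)) y)"
        using that F_R by (simp add: g_def flip: cinner_commute)
      also have "\<dots> = cinner x y"
        using that by (intro generalized_resolvent_symmetry[OF R]) auto
      finally show ?thesis .
    qed
    ultimately have "g \<zeta> = cinner x y"
      by (rule boundary_value_eq[OF _ \<Delta>_props(4)[OF that]])
    then show ?thesis
      by (simp add: g_def \<Delta>_props(3)[OF that] flip: cinner_commute)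
  qed
  \<comment> \<open>\<open>R z\<close> inverts \<open>1 - z V\<close> on \<open>D\<close> for every \<open>z\<close> in the disc, and this survives the limit\<close>
  have F_left: "F \<zeta> (x - \<zeta> *\<^sub>C V x) = x" if "\<zeta> \<in> \<Delta>" "x \<in> D" for \<zeta> x
  proof (rule cinner_eqI)
    fix y
    have F_split: "cinner (F z (x - z *\<^sub>C V x)) y = cinner (F z x) y - z * cinner (F z (V x)) y"
      if "z \<in> ?\<Omega>" for z
    proof -
      have lin: "clinear_on UNIV (F z)"
        using F_bcl[OF that] by (simp add: bounded_clinear_on_def)
      show ?thesis
        by (simp add: clinear_on_diff[OF lin] clinear_onD(2)[OF lin] cinner_diff_left cinner_scaleC_left)
    qed
    have "cinner (F \<zeta> x) y - \<zeta> * cinner (F \<zeta> (V x)) y = cinner x y"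
    proof (rule boundary_value_eq[where g="\<lambda>z. cinner (F z x) y - z * cinner (F z (V x)) y"])
      show "isCont (\<lambda>z. cinner (F z x) y - z * cinner (F z (V x)) y) \<zeta>"
        using F_isCont[OF \<open>\<zeta> \<in> \<Delta>\<close>] by (intro continuous_intros)
      fix z :: complex assume "z \<in> ball 0 1"
      then have "F z (x - z *\<^sub>C oplus_op D V (C z) x) = x"
        using F_R[of z] inin(2)[of z] inv_f_f[OF bij_is_inj[OF inin(1)[of z]], of x] by simp
      then show "cinner (F z x) y - z * cinner (F z (V x)) y = cinner x y"
        using F_split[of z] \<open>z \<in> ball 0 1\<close> oplus_op_D[OF inin(5) \<open>x \<in> D\<close>, of z] by auto
    qed (rule \<Delta>_props(4)[OF \<open>\<zeta> \<in> \<Delta>\<close>])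
    then show "cinner (F \<zeta> (x - \<zeta> *\<^sub>C V x)) y = cinner x y"
      using F_split[of \<zeta>] \<open>\<zeta> \<in> \<Delta>\<close> by simp
  qed
  have F_bij: "bij (F z)" if "z \<in> ?X" for z
  proof (cases "z \<in> \<Delta>")
    case True
    then show ?thesis
      using F_bcl sym by (intro real_part_half_bij) auto
  next
    case False
    then have "cmod z < 1"
      using that by auto
    then show ?thesis
      using F_R[of z] inin(1,2)[of z] by (simp add: bij_imp_bij_inv)
  qed
  define S where "S z = inv (F z)" for z
  have S_lin: "clinear_on UNIV (S z)" if "z \<in> ?X" for z
    unfolding S_def using F_bcl[of z] that by (intro clinear_on_inv F_bij) (auto simp: bounded_clinear_on_def)
  have FS: "S z (F z x) = x" "F z (S z x) = x" if "z \<in> ?X" for z x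
    using F_bij[OF that] by (simp_all add: S_def bij_is_surj surj_f_inv_f bij_is_inj)
  have S_ball: "S z x = x - z *\<^sub>C oplus_op D V (C z) x" if "z \<in> ball 0 1" for z x
    using F_R[of z] inin(1,2)[of z] that by (simp add: S_def inv_inv_eq)
  have S_le: "norm (S z x) \<le> 2 * norm x" if "z \<in> ?X" for z x
  proof (cases "z \<in> \<Delta>")
    case True
    then show ?thesis
      using real_part_half_bounded_below[of "F z" "S z x"] sym FS(2)[of z x] by simp
  next
    case False
    then have "z \<in> ball 0 1"
      using that by blast
    then have "cmod z * norm (oplus_op D V (C z) x) \<le> 1 * norm x"
      using inin(3)[of z x] by (intro mult_mono) auto
    then show ?thesis
      using norm_triangle_ineq4[of x "z *\<^sub>C oplus_op D V (C z) x"] S_ball[OF \<open>z \<in> ball 0 1\<close>] by simp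
  qed
  have S_cont: "norm_continuous_on ?X UNIV S"
  proof (rule norm_continuous_on_inverse)
    show "norm_continuous_on ?X UNIV F"
      using F_cont by (rule norm_continuous_on_subset) auto
    show "bounded_clinear_on UNIV (S z)" if "z \<in> ?X" for z
      using S_lin[OF that] S_le[OF that] unfolding bounded_clinear_on_def by blast
  qed (use FS in auto)
  define T where "T \<zeta> x = inverse \<zeta> *\<^sub>C (x - S \<zeta> x)" for \<zeta> x
  have S_T: "x - \<zeta> *\<^sub>C T \<zeta> x = S \<zeta> x" if "\<zeta> \<in> \<Delta>" for \<zeta> x
    using \<Delta>_props(2)[OF that] by (simp add: T_def)
  have T_lin: "clinear_on UNIV (T \<zeta>)" if "\<zeta> \<in> \<Delta>" for \<zeta>
    using clinear_onD[OF S_lin[of \<zeta>]] that unfolding clinear_on_def T_def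
    by (simp add: cvec.scale_right_diff_distrib cvec.scale_right_distrib scaleC_scaleC mult.commute)
  have T_iso: "cinner (T \<zeta> x) (T \<zeta> y) = cinner x y" if "\<zeta> \<in> \<Delta>" for \<zeta> x y
  proof -
    have "inverse \<zeta> * cnj (inverse \<zeta>) = 1"
      using \<Delta>_props(1)[OF that] by (simp flip: inverse_mult_distrib)
    moreover have "cinner x (S \<zeta> y) + cinner (S \<zeta> x) y = cinner (S \<zeta> x) (S \<zeta> y)"
      using sym[OF that, of "S \<zeta> x" "S \<zeta> y"] FS(2)[of \<zeta>] that by simp
    moreover have "cinner (T \<zeta> x) (T \<zeta> y) = (inverse \<zeta> * cnj (inverse \<zeta>)) * cinner (x - S \<zeta> x) (y - S \<zeta> y)"
      by (simp add: T_def cinner_scaleC_left cinner_scaleC_right)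
    ultimately show ?thesis
      by (simp add: cinner_diff_left cinner_diff_right algebra_simps)
  qed
  have T_D: "T \<zeta> x = V x" if "\<zeta> \<in> \<Delta>" "x \<in> D" for \<zeta> x
  proof -
    have "S \<zeta> x = x - \<zeta> *\<^sub>C V x"
      using FS(1)[of \<zeta> "x - \<zeta> *\<^sub>C V x"] F_left[OF that] that by simp
    then show ?thesis
      using \<Delta>_props(2)[OF that(1)] by (simp add: T_def)
  qed
  have S_bij: "bij (\<lambda>x. x - \<zeta> *\<^sub>C T \<zeta> x)" if "\<zeta> \<in> \<Delta>" for \<zeta>
    using F_bij[of \<zeta>] that unfolding S_T[OF that] S_def by (simp add: bij_imp_bij_inv)
  have T_onto: "T \<zeta> ` N0 = Ninf" if "\<zeta> \<in> \<Delta>" for \<zeta>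
  proof -
    have N: "x \<in> N0 \<longleftrightarrow> T \<zeta> x \<in> Ninf" for x
    proof -
      have "cinner x d = cinner (T \<zeta> x) (V d)" if "d \<in> D" for d
        using T_iso[OF \<open>\<zeta> \<in> \<Delta>\<close>, of x d] T_D[OF \<open>\<zeta> \<in> \<Delta>\<close> that] by simp
      then show ?thesis
        by (simp add: ortho_compl_def)
    qed
    have "surj (T \<zeta>)"
      using T_lin[OF that] T_iso[OF that] \<Delta>_props(4)[OF that] bij_is_surj[OF S_bij[OF that]]
      by (rule isometry_surj_if_resolvent_surj)
    show ?thesis
    proof (rule set_eqI)
      fix y
      obtain x where "y = T \<zeta> x"
        using surjD[OF \<open>surj (T \<zeta>)\<close>, of y] by blast
      then show "y \<in> T \<zeta> ` N0 \<longleftrightarrow> y \<in> Ninf"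
        using N by blast
    qed
  qed
  define C' where "C' z = (if z \<in> ball 0 1 then C z else T z)" for z
  have C'_ball: "C' z = C z" if "z \<in> ball 0 1" for z
    using that by (simp add: C'_def)
  have C'_arc: "C' z = T z" if "z \<in> \<Delta>" for z
    using \<Delta>_props(5)[OF that] by (simp add: C'_def)
  have T_norm: "norm (T \<zeta> x) = norm x" if "\<zeta> \<in> \<Delta>" for \<zeta> x
    using T_iso[OF that, of x x] by (simp add: cinner_self flip: of_real_power)
  have C'_contr: "norm (C' z h) \<le> norm h" if "z \<in> ?X" "h \<in> N0" for z h
    using that inin(7)[of z h] T_norm[of z h] C'_ball[of z] C'_arc[of z] by auto
  have S_C': "z *\<^sub>C C' z h = h - S z h" if "z \<in> ?X" "h \<in> N0" for z h
  proof (cases "z \<in> \<Delta>")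
    case True
    then show ?thesis
      using S_T[OF True, of h] C'_arc[OF True] by (simp add: algebra_simps)
  next
    case False
    then have "z \<in> ball 0 1"
      using that by blast
    then show ?thesis
      using S_ball[of z h] C'_ball[of z] oplus_op_N0[OF that(2)] by simp
  qed
  have C_cont: "norm_continuous_on (ball 0 1) N0 C"
    using C by (intro analytic_op_imp_norm_continuous) (simp_all add: inin_corresponds_def schur_class_def N_sp_0)
  have "norm_continuous_on ?X N0 C'"
  proof (rule norm_continuous_onI)
    show "bounded_clinear_on N0 (C' z)" if "z \<in> ?X" for z
    proof -
      have "clinear_on N0 (C' z)"
        using that inin(5)[of z] T_lin[of z] C'_ball[of z] C'_arc[of z] by (auto simp: clinear_on_def)
      then show ?thesis
        using C'_contr[OF that] unfolding bounded_clinear_on_def by (metis mult_1)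
    qed
    fix z and e :: real assume "z \<in> ?X" "e > 0"
    show "\<exists>d>0. \<forall>w\<in>?X. dist w z < d \<longrightarrow> (\<forall>h\<in>N0. norm (C' w h - C' z h) \<le> e * norm h)"
    proof (cases "z \<in> \<Delta>")
      case False
      then have "z \<in> ball 0 1"
        using \<open>z \<in> ?X\<close> by blast
      then obtain d where "d > 0"
        and d: "\<And>w h. w \<in> ball 0 1 \<Longrightarrow> dist w z < d \<Longrightarrow> h \<in> N0 \<Longrightarrow> norm (C w h - C z h) \<le> e * norm h"
        using norm_continuous_onD(2)[OF C_cont _ \<open>e > 0\<close>] by blast
      have "norm (C' w h - C' z h) \<le> e * norm h"
        if "dist w z < min d (1 - cmod z)" "h \<in> N0" for w h
      proof -
        have "w \<in> ball 0 1"
          using that(1) norm_triangle_sub[of w z] by (simp add: dist_norm)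
        then show ?thesis
          using d[of w h] that \<open>z \<in> ball 0 1\<close> by (simp add: C'_ball)
      qed
      then show ?thesis
        using \<open>d > 0\<close> \<open>z \<in> ball 0 1\<close> by (intro exI[of _ "min d (1 - cmod z)"]) auto
    next
      case True
      have "e / 2 > 0"
        using \<open>e > 0\<close> by simp
      then obtain d where "d > 0" and d: "\<And>w x. w \<in> ?X \<Longrightarrow> dist w z < d \<Longrightarrow> norm (S w x - S z x) \<le> e / 2 * norm x"
        using norm_continuous_onD(2)[OF S_cont \<open>z \<in> ?X\<close>] by blast
      have "norm (C' w h - C' z h) \<le> e * norm h"
        if "w \<in> ?X" "dist w z < min d (e / 2)" "h \<in> N0" for w h
      proof -
        \<comment> \<open>multiplying by \<open>z\<close>, of modulus one, expresses both terms by \<open>S\<close> without dividing by \<open>w\<close>\<close>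
        have "z *\<^sub>C (C' w h - C' z h) = (z - w) *\<^sub>C C' w h - (S w h - S z h)"
          using S_C'[OF that(1,3)] S_C'[OF \<open>z \<in> ?X\<close> that(3)]
          by (simp add: cvec.scale_left_diff_distrib cvec.scale_right_diff_distrib)
        then have "norm (z *\<^sub>C (C' w h - C' z h)) \<le> norm ((z - w) *\<^sub>C C' w h) + norm (S w h - S z h)"
          by (simp only: norm_triangle_ineq4)
        then have "norm (C' w h - C' z h) \<le> cmod (z - w) * norm (C' w h) + norm (S w h - S z h)"
          using \<Delta>_props(4)[OF True] by simp
        also have "\<dots> \<le> e / 2 * norm h + e / 2 * norm h"
          using that C'_contr[OF that(1,3)] d[OF that(1)] \<open>e > 0\<close>
          by (intro add_mono mult_mono) (auto simp: dist_norm norm_minus_commute)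
        finally show ?thesis
          by simp
      qed
      then show ?thesis
        using \<open>d > 0\<close> \<open>e > 0\<close> by (intro exI[of _ "min d (e / 2)"]) auto
    qed
  qed
  moreover have "inj_on (\<lambda>x. C' \<zeta> x - W_op D V \<zeta> x) N0 \<and> (\<lambda>x. C' \<zeta> x - W_op D V \<zeta> x) ` N0 = Ninf"
    if "\<zeta> \<in> \<Delta>" for \<zeta>
  proof -
    interpret boundary_point D V \<zeta>
      by (rule arc_boundary_point[OF that])
    show ?thesis
      using bij_resolvent_iff[of "T \<zeta>"] T_lin[OF that] T_iso[OF that] T_D[OF that] S_bij[OF that]
      by (simp add: C'_arc[OF that])
  qed
  ultimately have "admissible_boundary_values D V \<Delta> C C'"
    unfolding admissible_boundary_values_def N_sp_0 N_inf using C'_ball C'_arc T_norm T_onto by simp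
  then show ?thesis
    by blast
qed

end

theorem theorem5p3:
  fixes V :: "'a::separable_chilbert \<Rightarrow> 'a"
    and D :: "'a set"
    and \<Delta> :: "complex set"
    and J :: "'a \<Rightarrow> 'b::separable_chilbert"
    and U :: "'b \<Rightarrow> 'b"
    and R C :: "complex \<Rightarrow> 'a \<Rightarrow> 'a"
  assumes "closed_isometric D V"
    and "open_arc \<Delta>"
    and "\<forall>\<zeta>\<in>\<Delta>. regular_type_point D V (inverse \<zeta>)"
    and "\<forall>\<zeta>\<in>\<Delta>. ortho_proj (M_inf D V) ` M_sp D V \<zeta> = M_inf D V"
    and "generalized_resolvent D V J U R"
    and "inin_corresponds D V R C"
  shows "has_analytic_continuation R \<Delta> \<longleftrightarrow>
    (\<exists>C'. (\<forall>l\<in>ball 0 1. \<forall>x\<in>N_sp D V 0. C' l x = C l x) \<and>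
       norm_continuous_on (ball 0 1 \<union> \<Delta>) (N_sp D V 0) C' \<and>
       (\<forall>l\<in>\<Delta>. (\<forall>x\<in>N_sp D V 0. norm (C' l x) = norm x) \<and> C' l ` N_sp D V 0 = N_inf D V) \<and>
       (\<forall>l\<in>\<Delta>. inj_on (\<lambda>x. C' l x - W_op D V l x) (N_sp D V 0) \<and>
          (\<lambda>x. C' l x - W_op D V l x) ` N_sp D V 0 = N_inf D V))"
proof -
  interpret closed_isometry D V
    by unfold_locales (rule assms(1))
  have proj: "ortho_proj (V ` D) ` M_sp D V \<zeta> = V ` D" if "\<zeta> \<in> \<Delta>" for \<zeta>
    using assms(4) that by (simp add: M_inf_def)
  note hyps = assms(1,2) bspec[OF assms(3)] proj assms(5,6)
  have "has_analytic_continuation R \<Delta> \<longleftrightarrow> (\<exists>C'. admissible_boundary_values D V \<Delta> C C')"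
    using continuation_from_boundary_values[OF hyps] boundary_values_from_continuation[OF hyps] by blast
  then show ?thesis
    unfolding admissible_boundary_values_def .
qed

end
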